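(* For any $\alpha\in(-2,1)$, the apsidal angle $\Delta_\alpha\theta$ of the bounded orbits of the planar one-centre problem with potential $V_\alpha$, regarded as a function of the orbital eccentricity $e\in(0,1)$, is monotonic in $e$, and $$\frac{\partial \Delta_\alpha\theta}{\partial e}<0 .$$
   Context: For $x>0$ let $V_\alpha(x)=\frac{1}{\alpha}\frac{1}{x^{\alpha}}$ if $\alpha\neq 0$ and $V_0(x)=-\log x$. The one-centre problem is $\ddot u=\nabla\big(V_\alpha(|u|)\big)$, $u\in\mathbb{R}^2$, i.e. with $r=|u|$ the radial equation is $\ddot r-\frac{\ell^2}{r^3}+\frac{1}{r^{\alpha+1}}=0$ (attractive force of magnitude $r^{-(\alpha+1)}$). The conserved quantities are the energy $E=\frac12|\dot u|^2-V_\alpha(|u|)$ and the magnitude $\ell=|u\wedge\dot u|$ of the angular momentum. For a choice of $E$ and $\ell>0$ giving a bounded non-circular orbit, let $0<r_-<r_+$ be the apsidal distances, i.e. the two zeros of $r\mapsto 2(E+V_\alpha(r))-\frac{\ell^2}{r^2}$ (which is positive on $(r_-,r_+)$). The apsidal angle is $$\Delta_\alpha\theta=\int_{r_-}^{r_+}\frac{\ell}{r^2\sqrt{2\big(E+V_\alpha(r)\big)-\frac{\ell^2}{r^2}}}\,dr .$$ Both $E$ and $\ell$ are determined by $(r_-,r_+)$, and, for fixed $\alpha$, $\Delta_\alpha\theta$ depends only on the ratio $r_+/r_-$. Hence it is a function of the orbital eccentricity $e=\frac{r_+-r_-}{r_++r_-}\in(0,1)$. *)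

theory Defs
  imports "HOL-Analysis.Analysis"
begin

definition V :: "real \<Rightarrow> real \<Rightarrow> real" where
  "V \<alpha> x = (if \<alpha> = 0 then - ln x else (1 / \<alpha>) * (1 / x powr \<alpha>))"

text \<open>
  By conservation of energy and angular momentum, the function below is the squared radial
  velocity along an orbit of energy \<open>E\<close> and angular momentum \<open>l\<close>.
\<close>

definition radial :: "real \<Rightarrow> real \<Rightarrow> real \<Rightarrow> real \<Rightarrow> real" where
  "radial \<alpha> E l r = 2 * (E + V \<alpha> r) - l\<^sup>2 / r\<^sup>2"

text \<open>
  \<open>E\<close> and \<open>l\<close> give a bounded non-circular orbit whose apsidal distances are
  \<open>rm\<close> (pericentre) and \<open>rp\<close> (apocentre). The restriction to positive radii in the zero set
  is needed because the library functions involved are total.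
\<close>

definition bounded_orbit :: "real \<Rightarrow> real \<Rightarrow> real \<Rightarrow> real \<Rightarrow> real \<Rightarrow> bool" where
  "bounded_orbit \<alpha> E l rm rp \<longleftrightarrow>
     0 < l \<and> 0 < rm \<and> rm < rp \<and>
     {r. 0 < r \<and> radial \<alpha> E l r = 0} = {rm, rp} \<and>
     (\<forall>r\<in>{rm<..<rp}. 0 < radial \<alpha> E l r)"

definition eccentricity :: "real \<Rightarrow> real \<Rightarrow> real" where
  "eccentricity rm rp = (rp - rm) / (rp + rm)"

definition apsidal_integrand :: "real \<Rightarrow> real \<Rightarrow> real \<Rightarrow> real \<Rightarrow> real" where
  "apsidal_integrand \<alpha> E l r = l / (r\<^sup>2 * sqrt (radial \<alpha> E l r))"

definition orbit_apsidal_angle :: "real \<Rightarrow> real \<Rightarrow> real \<Rightarrow> real \<Rightarrow> real \<Rightarrow> real" where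
  "orbit_apsidal_angle \<alpha> E l rm rp = (LINT r:{rm<..<rp}|lborel. apsidal_integrand \<alpha> E l r)"

text \<open>
  The apsidal angle as a function of the eccentricity: the common value of the apsidal
  angles of all bounded non-circular orbits of eccentricity \<open>e\<close>. It is meaningful only
  if such orbits exist and share one value.
\<close>

definition apsidal_angle :: "real \<Rightarrow> real \<Rightarrow> real" where
  "apsidal_angle \<alpha> e =
     (THE T. \<exists>E l rm rp. bounded_orbit \<alpha> E l rm rp \<and> eccentricity rm rp = e \<and>
                          T = orbit_apsidal_angle \<alpha> E l rm rp)"

end

theory Submission
  imports Defs
begin

text \<open>
  Put \<open>r = r0 exp (- dlog x / q)\<close>, where \<open>r0\<close> is the radius at which \<open>r\<^sup>2 (E + V r)\<close> is maximal and
  \<open>q\<close> is \<open>2 - \<alpha>\<close> for \<open>\<alpha> > 0\<close> and \<open>2\<close> otherwise.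
  On an orbit \<open>r\<^sup>2 radial / l\<^sup>2 = (1 + s) / (1 + level x) - 1\<close> with
  \<open>level x = exp (dlog x) / (1 + x) - 1\<close>, where \<open>dlog x = - ln (1 - \<epsilon> x) / \<epsilon>\<close> and the single
  parameter \<open>\<epsilon>\<close> is \<open>\<alpha> / (2 - \<alpha>)\<close> for \<open>\<alpha> > 0\<close> and \<open>- \<alpha> / 2\<close> for \<open>\<alpha> \<le> 0\<close>; this identifies the
  ranges \<open>(0, 1)\<close> and \<open>(-2, 0)\<close> of \<open>\<alpha>\<close>, and \<open>\<epsilon> = 1\<close> is isochronous.

  Substituting \<open>level x = s t\<close> on both sides of \<open>x = 0\<close> turns the apsidal angle, up to a constant, into
  the integral of \<open>weight (s t) / sqrt (t (1 - t))\<close> over \<open>0 < t < 1\<close>, where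
  \<open>weight u = (a - l) sqrt (u / (1 + u))\<close> and \<open>a > 0 > l\<close> solve \<open>level (1 / a) = level (1 / l) = u\<close>.
  So it suffices that \<open>weight\<close> has negative derivative. As functions of \<open>ln (1 + u)\<close> both \<open>a\<close> and \<open>l\<close>
  solve \<open>r' = - r (r + 1) (r - \<epsilon>) / (1 + \<epsilon>)\<close>, which reduces the claim to a lower bound for the
  divided difference of this cubic at \<open>a\<close> and \<open>l\<close>; that bound propagates along the flow
  because \<open>(1 - \<epsilon>) / 2 < - (a + l) < 1 - \<epsilon>\<close>.
\<close>

section \<open>Calculus on the real line and the arcsine kernel\<close>

lemma DERIV_inverse_function_open:
  fixes f g :: "real \<Rightarrow> real"
  assumes "open S" "g y \<in> S" and der: "\<And>x. x \<in> S \<Longrightarrow> DERIV f x :> f' x"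
    and "f' (g y) \<noteq> 0" and "\<And>x. x \<in> S \<Longrightarrow> g (f x) = x" and "f (g y) = y"
  shows "DERIV g y :> inverse (f' (g y))"
  unfolding has_field_derivative_def
\<comment> \<open>The inverses treated later are given by \<open>THE\<close>, so their continuity is
  not known beforehand. Here \<open>g\<close> only has to be a left inverse of the continuous
  \<open>f\<close> on an open set.\<close>
proof (rule has_derivative_inverse_strong_x[OF assms(1,2) _ assms(5) _ _ assms(6)])
  show "continuous_on S f"
    by (intro continuous_at_imp_continuous_on ballI DERIV_isCont[OF der])
  show "(f has_derivative (*) (f' (g y))) (at (g y))"
    using der[OF assms(2)] by (simp add: has_field_derivative_def)
qed (use assms(4) in auto)

lemma DERIV_neg_imp_less:
  fixes f :: "real \<Rightarrow> real"
  assumes "x < y" and "\<And>z. x \<le> z \<Longrightarrow> z \<le> y \<Longrightarrow> DERIV f z :> f' z"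
    and "\<And>z. x \<le> z \<Longrightarrow> z \<le> y \<Longrightarrow> f' z < 0"
  shows "f y < f x"
  by (rule DERIV_neg_imp_decreasing[OF assms(1)]) (use assms(2,3) in blast)

lemma DERIV_pos_imp_less:
  fixes f :: "real \<Rightarrow> real"
  assumes "x < y" and "\<And>z. x \<le> z \<Longrightarrow> z \<le> y \<Longrightarrow> DERIV f z :> f' z"
    and "\<And>z. x \<le> z \<Longrightarrow> z \<le> y \<Longrightarrow> 0 < f' z"
  shows "f x < f y"
  by (rule DERIV_pos_imp_increasing[OF assms(1)]) (use assms(2,3) in blast)

text \<open>A decreasing function lies above its limit. Comparison with the value at
  \<open>a + 1\<close> makes the inequality strict.\<close>

lemma tendsto_0_decreasing_imp_pos:
  fixes f :: "real \<Rightarrow> real"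
  assumes lim: "(f \<longlongrightarrow> 0) at_top"
    and der: "\<And>z. a \<le> z \<Longrightarrow> DERIV f z :> f' z" and neg: "\<And>z. a \<le> z \<Longrightarrow> f' z < 0"
  shows "0 < f a"
proof -
  have dec: "f y < f x" if "a \<le> x" "x < y" for x y
    by (rule DERIV_neg_imp_less[OF that(2), of f f']) (use der neg that in auto)
  have "eventually (\<lambda>z. f z \<le> f (a + 1)) at_top"
    using eventually_gt_at_top[of "a + 1"]
    by eventually_elim (use dec[of "a + 1"] in \<open>auto intro: less_imp_le\<close>)
  then have "0 \<le> f (a + 1)"
    by (intro tendsto_upperbound[OF lim]) auto
  with dec[of a "a + 1"] show ?thesis by simp
qed

text \<open>Dominated convergence along sequences tending to \<open>x\<close>: by the mean value
  inequality the bound \<open>w\<close> on the derivatives also bounds the difference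
  quotients.\<close>

lemma has_real_derivative_integral:
  fixes f f' :: "real \<Rightarrow> 'a \<Rightarrow> real"
  assumes d: "0 < d"
    and int: "\<And>y. y \<in> ball x d \<Longrightarrow> integrable M (f y)"
    and der: "\<And>y t. y \<in> ball x d \<Longrightarrow> t \<in> space M \<Longrightarrow> DERIV (\<lambda>y. f y t) y :> f' y t"
    and bound: "\<And>y t. y \<in> ball x d \<Longrightarrow> t \<in> space M \<Longrightarrow> \<bar>f' y t\<bar> \<le> w t"
    and w: "integrable M w" and meas: "f' x \<in> borel_measurable M"
  shows "DERIV (\<lambda>y. \<integral>t. f y t \<partial>M) x :> (\<integral>t. f' x t \<partial>M)"
proof -
  have x: "x \<in> ball x d" using d by simp
  have "((\<lambda>y. ((\<integral>t. f y t \<partial>M) - (\<integral>t. f x t \<partial>M)) / (y - x)) \<longlongrightarrow> (\<integral>t. f' x t \<partial>M)) (at x within ball x d)"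
    unfolding tendsto_at_iff_sequentially comp_def
  proof (intro allI impI)
    fix X :: "nat \<Rightarrow> real"
    assume X: "\<forall>i. X i \<in> ball x d - {x}" and lim: "X \<longlonglongrightarrow> x"
    have "(\<lambda>i. \<integral>t. (f (X i) t - f x t) / (X i - x) \<partial>M) \<longlonglongrightarrow> (\<integral>t. f' x t \<partial>M)"
    proof (rule integral_dominated_convergence[where w = w])
      show "(\<lambda>t. (f (X i) t - f x t) / (X i - x)) \<in> borel_measurable M" for i
        using int[of "X i"] int[OF x] X
        by (intro borel_measurable_divide borel_measurable_diff borel_measurable_const) auto
      show "AE t in M. (\<lambda>i. (f (X i) t - f x t) / (X i - x)) \<longlonglongrightarrow> f' x t"
      proof (rule AE_I2)
        fix t assume t: "t \<in> space M"
        have "((\<lambda>y. (f y t - f x t) / (y - x)) \<longlongrightarrow> f' x t) (at x)"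
          using der[OF x t] by (simp add: has_field_derivative_iff)
        moreover have "filterlim X (at x) sequentially"
          using X lim by (auto simp: filterlim_at)
        ultimately show "(\<lambda>i. (f (X i) t - f x t) / (X i - x)) \<longlonglongrightarrow> f' x t"
          by (rule filterlim_compose)
      qed
      show "AE t in M. norm ((f (X i) t - f x t) / (X i - x)) \<le> w t" for i
      proof (rule AE_I2)
        fix t assume t: "t \<in> space M"
        have "norm (f (X i) t - f x t) \<le> w t * norm (X i - x)"
        proof (rule field_differentiable_bound[of "ball x d" "\<lambda>y. f y t" "\<lambda>y. f' y t"])
          show "((\<lambda>y. f y t) has_field_derivative f' z t) (at z within ball x d)" if "z \<in> ball x d" for z
            using der[OF that t] by (rule has_field_derivative_at_within)
        qed (use bound t X x in auto)
        moreover have "X i \<noteq> x" using X by auto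
        ultimately show "norm ((f (X i) t - f x t) / (X i - x)) \<le> w t"
          by (simp add: divide_simps)
      qed
    qed (use meas w in auto)
    moreover have "(\<integral>t. f (X i) t - f x t \<partial>M) = (\<integral>t. f (X i) t \<partial>M) - (\<integral>t. f x t \<partial>M)" for i
      using X by (intro Bochner_Integration.integral_diff int x) auto
    ultimately show "(\<lambda>i. ((\<integral>t. f (X i) t \<partial>M) - (\<integral>t. f x t \<partial>M)) / (X i - x)) \<longlonglongrightarrow> (\<integral>t. f' x t \<partial>M)"
      by simp
  qed
  then show ?thesis
    using at_within_open[OF x open_ball] by (simp add: has_field_derivative_iff)
qed

lemma tanh_artanh_real:
  fixes e :: real
  assumes "\<bar>e\<bar> < 1"
  shows "tanh (artanh e) = e"
proof -
  have p: "0 < 1 + e" "0 < 1 - e" using assms by auto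
  have "exp (- 2 * artanh e) = inverse (exp (ln ((1 + e) / (1 - e))))"
    by (simp add: artanh_def exp_minus)
  also have "\<dots> = (1 - e) / (1 + e)" using p by (simp only: exp_ln divide_pos_pos inverse_divide)
  finally have "tanh (artanh e) = (1 - (1 - e) / (1 + e)) / (1 + (1 - e) / (1 + e))"
    by (simp only: tanh_real_altdef)
  also have "\<dots> = e" using p by (simp add: field_simps)
  finally show ?thesis .
qed

lemma artanh_pos: "0 < e \<Longrightarrow> e < 1 \<Longrightarrow> 0 < artanh (e :: real)"
  by (simp add: artanh_def)

text \<open>The density of the arcsine law without the factor 1/pi. The indicator lets all integrals
  run over the whole line.\<close>

definition arcsine :: "real \<Rightarrow> real" where
  "arcsine t = indicator {0<..<1} t / sqrt (t * (1 - t))"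

lemma arcsine_nonneg: "0 \<le> arcsine t"
  by (auto simp: arcsine_def indicator_def)

lemma integrable_arcsine: "integrable lborel arcsine"
proof -
  have "set_integrable lborel {0<..<1} (\<lambda>t::real. t powr (1/2 - 1) * (1 - t) powr (1/2 - 1))"
    by (rule set_integrable_subset[OF integrable_Beta[of "1/2" "1/2"]]) auto
  moreover have "indicator {0<..<1} t *\<^sub>R (t powr (1/2 - 1) * (1 - t) powr (1/2 - 1)) = arcsine t" for t :: real
    by (auto simp: arcsine_def indicator_def powr_minus powr_half_sqrt real_sqrt_mult inverse_eq_divide)
  ultimately show ?thesis by (simp add: set_integrable_def)
qed

subsection \<open>The well in normalised coordinates\<close>

locale power_well =
  fixes \<epsilon> :: real
  assumes eps_nonneg: "0 \<le> \<epsilon>" and eps_less_1: "\<epsilon> < 1"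
begin

text \<open>The case \<epsilon> = 0 is the limit of the other one, so the logarithmic potential is
  treated together with the powers.\<close>

definition dlog :: "real \<Rightarrow> real" where
  "dlog x = (if \<epsilon> = 0 then x else - ln (1 - \<epsilon> * x) / \<epsilon>)"

text \<open>\<open>1 + level x\<close> is the factor by which \<open>r\<^sup>2 * (E + V r)\<close>
  at the coordinate \<open>x\<close> falls below its maximum at \<open>x = 0\<close>.\<close>

definition level :: "real \<Rightarrow> real" where
  "level x = exp (dlog x) / (1 + x) - 1"

lemma dlog_0 [simp]: "dlog 0 = 0"
  by (simp add: dlog_def)

lemma DERIV_dlog:
  assumes "\<epsilon> * x < 1"
  shows "DERIV dlog x :> 1 / (1 - \<epsilon> * x)"
proof (cases "\<epsilon> = 0")
  case True
  show ?thesis unfolding dlog_def[abs_def] using True by simp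
next
  case False
  have "DERIV (\<lambda>x. - ln (1 - \<epsilon> * x) / \<epsilon>) x :> 1 / (1 - \<epsilon> * x)"
    using assms False by (auto intro!: derivative_eq_intros simp: field_simps)
  then show ?thesis using False by (simp add: dlog_def[abs_def])
qed

lemma dlog_strict_mono:
  assumes "x < y" "\<epsilon> * y < 1"
  shows "dlog x < dlog y"
proof -
  have "\<epsilon> * z < 1" if "z \<le> y" for z
    using mult_left_mono[OF that eps_nonneg] assms(2) by linarith
  then show ?thesis
    using assms(1) by (intro DERIV_pos_imp_less[of x y dlog "\<lambda>z. 1 / (1 - \<epsilon> * z)"])
      (auto intro!: DERIV_dlog)
qed

lemma dlog_ge:
  assumes "\<epsilon> * x < 1"
  shows "x \<le> dlog x"
proof (cases "\<epsilon> = 0")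
  case True
  show ?thesis unfolding dlog_def using True by simp
next
  case False
  then have e: "0 < \<epsilon>" using eps_nonneg by simp
  have "ln (1 - \<epsilon> * x) \<le> - \<epsilon> * x"
    using ln_le_minus_one[of "1 - \<epsilon> * x"] assms by simp
  then show ?thesis using e False by (simp add: dlog_def field_simps)
qed

text \<open>The derivative has the sign of \<open>x\<close>: \<open>level\<close> is a well with its
  bottom at \<open>0\<close>.\<close>

lemma DERIV_level:
  assumes "-1 < x" "\<epsilon> * x < 1"
  shows "DERIV level x :> (1 + level x) * ((1 + \<epsilon>) * x / ((1 + x) * (1 - \<epsilon> * x)))"
proof -
  have e: "DERIV (\<lambda>x. exp (dlog x)) x :> exp (dlog x) * (1 / (1 - \<epsilon> * x))"
    using assms by (intro DERIV_chain2[OF DERIV_exp] DERIV_dlog) auto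
  have "DERIV (\<lambda>x. 1 + x) x :> 1" by (auto intro!: derivative_eq_intros)
  from DERIV_diff[OF DERIV_divide[OF e this] DERIV_const[of 1]] assms
  have "DERIV level x :> (exp (dlog x) * (1 / (1 - \<epsilon> * x)) * (1 + x) - exp (dlog x)) / ((1 + x) * (1 + x))"
    unfolding level_def[abs_def] by simp
  also have "exp (dlog x) * (1 / (1 - \<epsilon> * x)) * (1 + x) - exp (dlog x) =
      exp (dlog x) * (1 + \<epsilon>) * x / (1 - \<epsilon> * x)"
    using assms by (simp add: field_simps)
  finally have d: "DERIV level x :> exp (dlog x) * (1 + \<epsilon>) * x / (1 - \<epsilon> * x) / ((1 + x) * (1 + x))" .
  have "1 + level x = exp (dlog x) / (1 + x)" by (simp add: level_def)
  then show ?thesis using d by (simp add: mult_ac)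
qed

lemma level_0 [simp]: "level 0 = 0"
  by (simp add: level_def)

lemma one_plus_level_pos: "-1 < x \<Longrightarrow> 0 < 1 + level x"
  by (simp add: level_def)

lemma level_unbounded_right:
  assumes "0 < s"
  shows "\<exists>x>0. \<epsilon> * x < 1 \<and> s \<le> level x"
proof (cases "\<epsilon> = 0")
  case True
  \<comment> \<open>Any \<open>x\<close> with (1 + s)(1 + x) below (1 + x/2)^2 serves, since the
    latter is at most exp x.\<close>
  define x where "x = 4 * s + 4"
  have x: "0 < x" using assms by (simp add: x_def)
  have "(1 + s) * (1 + x) \<le> (1 + x / 2)\<^sup>2"
    using assms by (simp add: x_def power2_eq_square algebra_simps)
  also have "\<dots> \<le> (exp (x / 2))\<^sup>2"
    using x by (intro power_mono exp_ge_add_one_self) auto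
  also have "\<dots> = exp x" by (simp flip: exp_double)
  finally have "0 < x \<and> s \<le> exp x / (1 + x) - 1" using x by (simp add: field_simps)
  then show ?thesis unfolding level_def dlog_def using True by auto
next
  case False
  then have e: "0 < \<epsilon>" using eps_nonneg by simp
  \<comment> \<open>\<open>z\<close> is the value wanted for \<open>exp (dlog x)\<close>: as 1 + x
    stays below 1 + 1/\<epsilon>, it forces the quotient up to 1 + s. The next line solves
    \<open>dlog x = ln z\<close>.\<close>
  define z where "z = (1 + s) * (1 + 1 / \<epsilon>)"
  define x where "x = (1 - z powr - \<epsilon>) / \<epsilon>"
  have z: "1 < z" unfolding z_def using assms e
    by (simp add: field_simps add_pos_pos)
  have zp: "0 < z powr - \<epsilon>" "z powr - \<epsilon> < 1"
    using z e by (auto simp: powr_less_one)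
  have x: "0 < x" "\<epsilon> * x < 1" "x < 1 / \<epsilon>" using zp e by (auto simp: x_def field_simps)
  have "1 - \<epsilon> * x = z powr - \<epsilon>" using e by (simp add: x_def)
  then have "dlog x = ln z" using e z by (simp add: dlog_def ln_powr)
  then have "level x = z / (1 + x) - 1" using z by (simp add: level_def)
  moreover have "z / (1 + 1 / \<epsilon>) \<le> z / (1 + x)"
    using x z by (intro divide_left_mono) auto
  moreover have "1 + 1 / \<epsilon> \<noteq> 0" using e by (simp add: add_pos_pos less_imp_neq[symmetric])
  then have "z / (1 + 1 / \<epsilon>) = 1 + s" unfolding z_def by (rule nonzero_mult_div_cancel_right)
  ultimately show ?thesis using x by (intro exI[of _ x]) auto
qed

lemma level_unbounded_left:
  assumes "0 < s"
  shows "\<exists>x<0. -1 < x \<and> s \<le> level x"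
proof -
  \<comment> \<open>Since \<open>dlog x\<close> is at least \<open>x\<close>, the numerator of
    \<open>level x\<close> stays above \<open>exp (-1)\<close> on (-1, 0). The witness makes the
    denominator small enough.\<close>
  define x where "x = exp (-1) / (1 + s) - 1"
  have "exp (-1) < (1::real)" by simp
  then have "exp (-1) < 1 + s" using assms by linarith
  then have "exp (-1) / (1 + s) < 1" using assms by (simp add: field_simps)
  then have x: "x < 0" "-1 < x" using assms by (auto simp: x_def)
  have "-1 \<le> dlog x"
    using dlog_ge[of x] x eps_nonneg mult_nonneg_nonpos[of \<epsilon> x] by linarith
  then have "exp (-1) / (1 + x) \<le> exp (dlog x) / (1 + x)"
    using x by (intro divide_right_mono) auto
  moreover have "exp (-1) / (1 + x) = 1 + s" using assms by (simp add: x_def)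
  ultimately have "s \<le> level x" by (simp add: level_def)
  then show ?thesis using x by blast
qed

text \<open>
  A value \<open>s\<close> of \<^const>\<open>level\<close> is attained once on either side of \<open>0\<close>. In the reciprocal
  coordinate \<open>1 / x\<close> both branches satisfy the same differential equation with polynomial
  right-hand side.
\<close>

definition rlevel :: "real \<Rightarrow> real" where
  "rlevel r = level (1 / r)"

definition rrate :: "real \<Rightarrow> real" where
  "rrate r = r * (r + 1) * (r - \<epsilon>) / (1 + \<epsilon>)"

text \<open>With x = 1/r, the condition \<open>\<epsilon> < r\<close> describes the right side of
  the well, where x > 0 and \<epsilon> x < 1; \<open>r < -1\<close> describes the left side -1 < x <
  0.\<close>

lemma recip_domain:
  assumes "\<epsilon> < r \<or> r < -1"
  shows "-1 < 1 / r" "\<epsilon> * (1 / r) < 1" "r \<noteq> 0"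
  using assms eps_nonneg eps_less_1 by (auto simp: field_simps)

lemma DERIV_rlevel:
  assumes "\<epsilon> < r \<or> r < -1"
  shows "DERIV rlevel r :> - (1 + rlevel r) / rrate r"
proof -
  note d = recip_domain[OF assms]
  have n: "r + 1 \<noteq> 0" "r - \<epsilon> \<noteq> 0" "1 + \<epsilon> \<noteq> 0" using assms eps_nonneg eps_less_1 by auto
  have inv: "DERIV (\<lambda>r. 1 / r) r :> - 1 / (r * r)"
    using d by (auto intro!: derivative_eq_intros simp: power2_eq_square)
  have e: "(1 + \<epsilon>) * (1/r) / ((1 + 1/r) * (1 - \<epsilon> * (1/r))) = (1 + \<epsilon>) * r / ((r + 1) * (r - \<epsilon>))"
    using d n by (simp add: divide_simps)
  have "DERIV rlevel r :> (1 + level (1/r)) * ((1 + \<epsilon>) * r / ((r + 1) * (r - \<epsilon>))) * (- 1 / (r * r))"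
    unfolding rlevel_def[abs_def]
    using DERIV_chain2[OF DERIV_level[OF d(1,2)] inv] unfolding e by simp
  moreover have "g * ((1 + \<epsilon>) * r / ((r + 1) * (r - \<epsilon>))) * (- 1 / (r * r)) = - g / rrate r" for g
    using d(3) n by (simp add: rrate_def divide_simps)
  ultimately show ?thesis unfolding rlevel_def by metis
qed

lemma one_plus_rlevel_pos: "\<epsilon> < r \<or> r < -1 \<Longrightarrow> 0 < 1 + rlevel r"
  unfolding rlevel_def by (intro one_plus_level_pos recip_domain)

lemma rrate_pos: "\<epsilon> < r \<Longrightarrow> 0 < rrate r"
  using eps_nonneg by (simp add: rrate_def)

lemma rrate_neg: "r < -1 \<Longrightarrow> rrate r < 0"
  using eps_nonneg by (simp add: rrate_def divide_less_0_iff mult_less_0_iff zero_less_mult_iff)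

lemma rlevel_strict_antimono_right:
  assumes "\<epsilon> < a" "a < a'"
  shows "rlevel a' < rlevel a"
proof (rule DERIV_neg_imp_less[OF assms(2)])
  fix z :: real assume "a \<le> z"
  then have z: "\<epsilon> < z" using assms by simp
  then show "DERIV rlevel z :> - (1 + rlevel z) / rrate z"
    by (intro DERIV_rlevel) simp
  show "- (1 + rlevel z) / rrate z < 0"
    using one_plus_rlevel_pos[of z] rrate_pos z by (intro divide_neg_pos) auto
qed

lemma rlevel_strict_mono_left:
  assumes "a < a'" "a' < -1"
  shows "rlevel a < rlevel a'"
proof (rule DERIV_pos_imp_less[OF assms(1)])
  fix z :: real assume "z \<le> a'"
  then have z: "z < -1" using assms by simp
  then show "DERIV rlevel z :> - (1 + rlevel z) / rrate z"
    by (intro DERIV_rlevel) simp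
  show "0 < - (1 + rlevel z) / rrate z"
    using one_plus_rlevel_pos[of z] rrate_neg z by (intro divide_neg_neg) auto
qed

lemma rlevel_inj_right:
  assumes "\<epsilon> < a" "\<epsilon> < a'" "rlevel a = rlevel a'"
  shows "a = a'"
  using assms rlevel_strict_antimono_right[of a a'] rlevel_strict_antimono_right[of a' a]
  by (cases a a' rule: linorder_cases) auto

lemma rlevel_inj_left:
  assumes "a < -1" "a' < -1" "rlevel a = rlevel a'"
  shows "a = a'"
  using assms rlevel_strict_mono_left[of a a'] rlevel_strict_mono_left[of a' a]
  by (cases a a' rule: linorder_cases) auto

lemma isCont_level: "-1 < x \<Longrightarrow> \<epsilon> * x < 1 \<Longrightarrow> isCont level x"
  using DERIV_level DERIV_isCont by blast

lemma level_tendsto_0: "(level \<longlongrightarrow> 0) (at 0)"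
  using isCont_level[of 0] by (simp add: isCont_def)

text \<open>Both ends of the \<open>r\<close> axis correspond to the bottom x = 0 of the
  well.\<close>

lemma rlevel_at_infinity: "(rlevel \<longlongrightarrow> 0) at_infinity"
proof -
  have "filterlim (\<lambda>r::real. 1 / r) (at 0) at_infinity"
    unfolding filterlim_at
  proof
    show "\<forall>\<^sub>F r::real in at_infinity. 1 / r \<in> UNIV \<and> 1 / r \<noteq> 0"
      using eventually_not_equal_at_infinity[of "0::real"] by eventually_elim simp
    show "((\<lambda>r::real. 1 / r) \<longlongrightarrow> 0) at_infinity"
      using tendsto_inverse_0[where 'a=real] by (simp add: divide_inverse)
  qed
  from filterlim_compose[OF level_tendsto_0 this] show ?thesis
    by (simp add: rlevel_def[abs_def])
qed

lemma rlevel_at_top: "(rlevel \<longlongrightarrow> 0) at_top"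
  by (rule tendsto_mono[OF at_top_le_at_infinity rlevel_at_infinity])

lemma rlevel_at_bot: "(rlevel \<longlongrightarrow> 0) at_bot"
  by (rule tendsto_mono[OF at_bot_le_at_infinity rlevel_at_infinity])

text \<open>On each side \<open>rlevel\<close> is strictly monotone and tends to 0 at the infinite
  end. A point one unit further out gives strictness.\<close>

lemma rlevel_pos:
  assumes "\<epsilon> < r \<or> r < -1"
  shows "0 < rlevel r"
  using assms
proof
  assume r: "\<epsilon> < r"
  have "eventually (\<lambda>z. rlevel z \<le> rlevel (r + 1)) at_top"
    using eventually_ge_at_top[of "r + 1"]
  proof eventually_elim
    fix z :: real assume "r + 1 \<le> z"
    then show "rlevel z \<le> rlevel (r + 1)"
      using rlevel_strict_antimono_right[of "r + 1" z] r by (cases "z = r + 1") auto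
  qed
  then have "0 \<le> rlevel (r + 1)"
    by (intro tendsto_upperbound[OF rlevel_at_top]) auto
  with rlevel_strict_antimono_right[of r "r+1"] r show ?thesis by simp
next
  assume r: "r < -1"
  have "eventually (\<lambda>z. rlevel z \<le> rlevel (r - 1)) at_bot"
    using eventually_le_at_bot[of "r - 1"]
  proof eventually_elim
    fix z :: real assume "z \<le> r - 1"
    then show "rlevel z \<le> rlevel (r - 1)"
      using rlevel_strict_mono_left[of z "r - 1"] r by (cases "z = r - 1") auto
  qed
  then have "0 \<le> rlevel (r - 1)"
    by (intro tendsto_upperbound[OF rlevel_at_bot]) auto
  with rlevel_strict_mono_left[of "r-1" r] r show ?thesis by simp
qed

lemma rlevel_surj_right:
  assumes "0 < s"
  shows "\<exists>a. \<epsilon> < a \<and> rlevel a = s"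
proof -
  obtain X where X: "0 < X" "\<epsilon> * X < 1" "s \<le> level X"
    using level_unbounded_right[OF assms] by blast
  have "\<epsilon> * x < 1" if "x \<le> X" for x
    using mult_left_mono[OF that eps_nonneg] X by linarith
  then have "continuous_on {0..X} level"
    by (intro continuous_at_imp_continuous_on ballI isCont_level) auto
  with X assms have "\<exists>x\<ge>0. x \<le> X \<and> level x = s"
    by (intro IVT') auto
  then obtain x where x: "0 \<le> x" "x \<le> X" "level x = s" by blast
  then have "0 < x" using assms by (cases "x = 0") auto
  moreover have "\<epsilon> * x < 1" using mult_left_mono[OF x(2) eps_nonneg] X by linarith
  ultimately show ?thesis using x by (intro exI[of _ "1/x"]) (auto simp: rlevel_def field_simps)
qed

lemma rlevel_surj_left:
  assumes "0 < s"
  shows "\<exists>a. a < -1 \<and> rlevel a = s"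
proof -
  obtain X where X: "X < 0" "-1 < X" "s \<le> level X"
    using level_unbounded_left[OF assms] by blast
  have "\<epsilon> * x < 1" if "x \<le> 0" for x
    using mult_nonneg_nonpos[OF eps_nonneg that] by linarith
  then have "continuous_on {X..0} level"
    using X by (intro continuous_at_imp_continuous_on ballI isCont_level) auto
  with X assms have "\<exists>x\<ge>X. x \<le> 0 \<and> level x = s"
    by (intro IVT2') auto
  then obtain x where x: "x \<le> 0" "X \<le> x" "level x = s" by blast
  then have "x < 0" using assms by (cases "x = 0") auto
  then show ?thesis using x X by (intro exI[of _ "1/x"]) (auto simp: rlevel_def field_simps)
qed

section \<open>The two branches as functions of the level\<close>

definition rright :: "real \<Rightarrow> real" where
  "rright s = (THE a. \<epsilon> < a \<and> rlevel a = s)"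

definition rleft :: "real \<Rightarrow> real" where
  "rleft s = (THE a. a < -1 \<and> rlevel a = s)"

lemma rright:
  assumes "0 < s"
  shows "\<epsilon> < rright s" "rlevel (rright s) = s"
proof -
  have "\<exists>!a. \<epsilon> < a \<and> rlevel a = s"
    using rlevel_surj_right[OF assms] by (auto intro: rlevel_inj_right)
  from theI'[OF this] show "\<epsilon> < rright s" "rlevel (rright s) = s"
    by (auto simp: rright_def)
qed

lemma rleft:
  assumes "0 < s"
  shows "rleft s < -1" "rlevel (rleft s) = s"
proof -
  have "\<exists>!a. a < -1 \<and> rlevel a = s"
    using rlevel_surj_left[OF assms] by (auto intro: rlevel_inj_left)
  from theI'[OF this] show "rleft s < -1" "rlevel (rleft s) = s"
    by (auto simp: rleft_def)
qed

lemma rright_rlevel: "\<epsilon> < a \<Longrightarrow> rright (rlevel a) = a"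
  by (rule rlevel_inj_right) (auto intro!: rright rlevel_pos)

lemma rleft_rlevel: "a < -1 \<Longrightarrow> rleft (rlevel a) = a"
  by (rule rlevel_inj_left) (auto intro!: rleft rlevel_pos)

lemma DERIV_rright:
  assumes "0 < s"
  shows "DERIV rright s :> - rrate (rright s) / (1 + s)"
proof -
  note r = rright[OF assms]
  have "DERIV rright s :> inverse (- (1 + rlevel (rright s)) / rrate (rright s))"
  proof (rule DERIV_inverse_function_open[where S = "{\<epsilon><..}" and f = rlevel])
    fix z :: real assume z: "z \<in> {\<epsilon><..}"
    then show "DERIV rlevel z :> - (1 + rlevel z) / rrate z" by (intro DERIV_rlevel) simp
    show "rright (rlevel z) = z" using z by (simp add: rright_rlevel)
  next
    show "- (1 + rlevel (rright s)) / rrate (rright s) \<noteq> 0"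
      using rrate_pos[OF r(1)] assms unfolding r(2) by simp
  qed (use r in simp_all)
  then show ?thesis
    unfolding r(2) inverse_divide minus_divide_right[symmetric] minus_divide_left .
qed

lemma DERIV_rleft:
  assumes "0 < s"
  shows "DERIV rleft s :> - rrate (rleft s) / (1 + s)"
proof -
  note r = rleft[OF assms]
  have "DERIV rleft s :> inverse (- (1 + rlevel (rleft s)) / rrate (rleft s))"
  proof (rule DERIV_inverse_function_open[where S = "{..< -1}" and f = rlevel])
    fix z :: real assume z: "z \<in> {..< -1}"
    then show "DERIV rlevel z :> - (1 + rlevel z) / rrate z" by (intro DERIV_rlevel) simp
    show "rleft (rlevel z) = z" using z by (simp add: rleft_rlevel)
  next
    show "- (1 + rlevel (rleft s)) / rrate (rleft s) \<noteq> 0"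
      using rrate_neg[OF r(1)] assms unfolding r(2) by simp
  qed (use r in simp_all)
  then show ?thesis
    unfolding r(2) inverse_divide minus_divide_right[symmetric] minus_divide_left .
qed

end

subsection \<open>Monotonicity of the weight\<close>

text \<open>
  If \<open>a\<close> and \<open>l\<close> move by \<open>r' = - P r / (1 + \<epsilon>)\<close>, the second claim reads
  \<open>0 < (1 + \<epsilon>) * D' + 2 * D\<^sup>2 + (1 + \<epsilon>) * D\<close>.
\<close>

lemma cubic_divided_difference_ineq:
  fixes a l \<epsilon> :: real
  defines "D \<equiv> a\<^sup>2 + a * l + l\<^sup>2 + (1 - \<epsilon>) * (a + l) - \<epsilon>"
    and "P \<equiv> \<lambda>r. r * (r + 1) * (r - \<epsilon>)"
  assumes e: "0 \<le> \<epsilon>" "\<epsilon> < 1" and a: "\<epsilon> < a" and l: "l < -1"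
    and sum: "(1 - \<epsilon>) / 2 < - (a + l)" "- (a + l) < 1 - \<epsilon>"
  shows "max 0 (a\<^sup>2 - 1) < D"
    and "0 < 2 * D\<^sup>2 + (1 + \<epsilon>) * D - (2 * a + l + (1 - \<epsilon>)) * P a - (2 * l + a + (1 - \<epsilon>)) * P l"
proof -
  \<comment> \<open>\<open>D\<close> and the expression of the second claim are symmetric in
    \<open>a\<close> and \<open>l\<close>, hence polynomials in their sum and product. The second
    one is linear in \<open>p\<close>, with slope \<open>k\<close>.\<close>
  define c where "c = 1 - \<epsilon>"
  define \<delta> where "\<delta> = - (a + l)"
  define p where "p = - (a * l)"
  define k where "k = c - 2 * c\<^sup>2 + 4 * c * \<delta> - 3 * \<delta>\<^sup>2"
  have c: "0 < c" "c \<le> 1" using e by (auto simp: c_def)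
  have d: "c / 2 < \<delta>" "\<delta> < c" using sum by (auto simp: c_def \<delta>_def)
  have \<epsilon>: "\<epsilon> = 1 - c" and ll: "l = - (a + \<delta>)" by (simp_all add: c_def \<delta>_def)
  have "0 < (a + 1) * (- l - 1)"
    using a l e by (intro mult_pos_pos) auto
  then have p: "1 - \<delta> < p" by (simp add: p_def \<delta>_def algebra_simps)
  have D: "D = p - (1 - \<delta>) * (\<delta> + (1 - c))"
    unfolding D_def p_def \<epsilon> ll by (simp add: power2_eq_square algebra_simps)
  have q: "(1 - \<delta>) * (\<delta> + (1 - c)) \<le> 1 - \<delta>"
    using mult_left_mono[of "\<delta> + (1 - c)" 1 "1 - \<delta>"] d c by simp
  have "a * a \<le> a * (- l)"
    using d c a e by (intro mult_left_mono) (auto simp: \<delta>_def)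
  then have "a\<^sup>2 \<le> p" by (simp add: p_def power2_eq_square)
  then have "a\<^sup>2 - 1 < D" using q D d c by linarith
  moreover have "0 < D" using p q D by linarith
  ultimately show "max 0 (a\<^sup>2 - 1) < D" by simp
  \<comment> \<open>This splitting shows that the slope is positive: the first summand is positive,
    and the bounds on \<open>\<delta>\<close> make both factors of the second one
    nonnegative.\<close>
  have k: "k = c * (1 - \<delta>) * (\<delta> + (1 - c)) + (c - \<delta>) * (3 * \<delta> - c - c * \<delta>)"
    by (simp add: k_def power2_eq_square algebra_simps)
  have "c * \<delta> \<le> \<delta>" using c d by (simp add: mult_left_le_one_le)
  then have "0 \<le> 3 * \<delta> - c - c * \<delta>" using d by linarith
  then have "0 \<le> (c - \<delta>) * (3 * \<delta> - c - c * \<delta>)"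
    using d by (intro mult_nonneg_nonneg) auto
  then have k1: "c * (1 - \<delta>) * (\<delta> + (1 - c)) \<le> k" using k by simp
  moreover have "0 < c * (1 - \<delta>) * (\<delta> + (1 - c))"
    using c d by (intro mult_pos_pos) auto
  ultimately have k0: "0 < k" by simp
  \<comment> \<open>As the slope is positive and p > 1 - \<delta>, it suffices to compare at p = 1 -
    \<delta>, where \<open>k1\<close> gives the bound.\<close>
  have "c * (1 - \<delta>)\<^sup>2 * (\<delta> + (1 - c)) = (1 - \<delta>) * (c * (1 - \<delta>) * (\<delta> + (1 - c)))"
    by (simp add: power2_eq_square)
  also have "\<dots> \<le> (1 - \<delta>) * k" using k1 d c by (intro mult_left_mono) auto
  also have "\<dots> < p * k" using p k0 by (intro mult_strict_right_mono)
  finally have "0 < p * k - c * (1 - \<delta>)\<^sup>2 * (\<delta> + (1 - c))" by simp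
  also have "\<dots> = 2 * D\<^sup>2 + (1 + \<epsilon>) * D - (2 * a + l + (1 - \<epsilon>)) * P a - (2 * l + a + (1 - \<epsilon>)) * P l"
    unfolding k_def D_def P_def p_def \<epsilon> ll by (simp add: power2_eq_square algebra_simps)
  finally show "0 < \<dots>" .
qed

context power_well
begin

section \<open>Bounds for the sum of the two branches\<close>

lemma DERIV_ln_rlevel:
  assumes "\<epsilon> < r \<or> r < -1"
  shows "DERIV (\<lambda>r. ln (1 + rlevel r)) r :> - 1 / rrate r"
proof -
  have d: "DERIV (\<lambda>r. 1 + rlevel r) r :> - (1 + rlevel r) / rrate r"
    using DERIV_add[OF DERIV_const[of 1] DERIV_rlevel[OF assms]] by simp
  have e: "1 / g * (- g / k) = - 1 / k" if "0 < g" for g k :: real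
    using that by simp
  show ?thesis
    using DERIV_chain2[OF DERIV_ln_divide d] one_plus_rlevel_pos[OF assms] unfolding e[OF one_plus_rlevel_pos[OF assms]] .
qed

text \<open>
  Comparing the two branches along \<open>l = - (a + \<eta>)\<close> reduces the bounds on \<open>a + l\<close> to the
  signs of polynomials.
\<close>

lemma branch_comparison:
  fixes \<eta> :: real
  defines "K \<equiv> \<lambda>z. ln (1 + rlevel z) - ln (1 + rlevel (- (z + \<eta>)))"
  assumes "\<epsilon> < z" "1 < z + \<eta>"
  shows "DERIV K z :> - 1 / rrate z - 1 / rrate (- (z + \<eta>))"
proof -
  have "DERIV (\<lambda>z. - (z + \<eta>)) z :> -1" by (auto intro!: derivative_eq_intros)
  moreover have "DERIV (\<lambda>r. ln (1 + rlevel r)) (- (z + \<eta>)) :> - 1 / rrate (- (z + \<eta>))"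
    using assms by (intro DERIV_ln_rlevel) auto
  ultimately have "DERIV (\<lambda>z. ln (1 + rlevel (- (z + \<eta>)))) z :> - 1 / rrate (- (z + \<eta>)) * -1"
    by (rule DERIV_chain2[rotated])
  moreover have "DERIV (\<lambda>r. ln (1 + rlevel r)) z :> - 1 / rrate z"
    using assms by (intro DERIV_ln_rlevel) auto
  ultimately have "DERIV K z :> - 1 / rrate z - (- 1 / rrate (- (z + \<eta>)) * -1)"
    unfolding K_def by (intro DERIV_diff)
  then show ?thesis by simp
qed

lemma branch_comparison_tendsto:
  "((\<lambda>z. ln (1 + rlevel z) - ln (1 + rlevel (- (z + \<eta>)))) \<longlongrightarrow> 0) at_top"
proof -
  have "filterlim (\<lambda>z. - (z + \<eta>)) at_bot at_top"
    unfolding filterlim_at_bot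
  proof
    fix Z
    show "\<forall>\<^sub>F z in at_top. - (z + \<eta>) \<le> Z"
      using eventually_ge_at_top[of "- Z - \<eta>"] by eventually_elim simp
  qed
  from filterlim_compose[OF rlevel_at_bot this]
  have "((\<lambda>z. ln (1 + rlevel z) - ln (1 + rlevel (- (z + \<eta>)))) \<longlongrightarrow> ln (1 + 0) - ln (1 + 0)) at_top"
    by (intro tendsto_intros rlevel_at_top) auto
  then show ?thesis by simp
qed

lemma rrate_minus: "- rrate (- b) = b * (b - 1) * (b + \<epsilon>) / (1 + \<epsilon>)"
  using eps_nonneg by (simp add: rrate_def field_simps)

text \<open>At b = z + 1 - \<epsilon> the mirrored cubic b (b - 1) (b + \<epsilon>) shares two
  factors with the cubic at \<open>z\<close>, and their difference is (z + 1) (z - \<epsilon>) (1 -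
  \<epsilon>) > 0. Hence \<open>K\<close> decreases to 0 and is positive, so the level at the mirror
  point is below \<open>s\<close>; a left branch beyond that point would contradict
  monotonicity.\<close>

lemma branch_sum_upper:
  assumes "0 < s"
  shows "- (rright s + rleft s) < 1 - \<epsilon>"
proof (rule ccontr)
  define a where "a = rright s"
  define K where "K = (\<lambda>z. ln (1 + rlevel z) - ln (1 + rlevel (- (z + (1 - \<epsilon>)))))"
  have a: "\<epsilon> < a" "rlevel a = s" using rright[OF assms] by (auto simp: a_def)
  assume "\<not> ?thesis"
  then have le: "rleft s \<le> - (a + (1 - \<epsilon>))" by (simp add: a_def)
  have neg: "- 1 / rrate z - 1 / rrate (- (z + (1 - \<epsilon>))) < 0" if "a \<le> z" for z
  proof -
    have z: "0 < z" "0 < z - \<epsilon>" "\<epsilon> < z" using that a eps_nonneg by auto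
    have "- rrate (- (z + (1 - \<epsilon>))) - rrate z = (z + 1) * (z - \<epsilon>) * (1 - \<epsilon>) / (1 + \<epsilon>)"
      unfolding rrate_minus unfolding rrate_def diff_divide_distrib[symmetric]
      by (rule arg_cong[of _ _ "\<lambda>x. x / (1 + \<epsilon>)"]) (simp add: algebra_simps)
    also have "0 < \<dots>" using z eps_nonneg eps_less_1 by (intro divide_pos_pos mult_pos_pos) auto
    finally have "rrate z < - rrate (- (z + (1 - \<epsilon>)))" by simp
    with rrate_pos[OF z(3)] have "1 / - rrate (- (z + (1 - \<epsilon>))) < 1 / rrate z"
      by (intro divide_strict_left_mono mult_pos_pos) auto
    then show ?thesis by simp
  qed
  have der: "DERIV K z :> - 1 / rrate z - 1 / rrate (- (z + (1 - \<epsilon>)))" if "a \<le> z" for z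
    unfolding K_def by (rule branch_comparison) (use that a in auto)
  have "(K \<longlongrightarrow> 0) at_top"
    unfolding K_def by (rule branch_comparison_tendsto)
  from tendsto_0_decreasing_imp_pos[OF this der neg] have "0 < K a" by simp
  then have "rlevel (- (a + (1 - \<epsilon>))) < s"
    using a one_plus_rlevel_pos[of a] one_plus_rlevel_pos[of "- (a + (1 - \<epsilon>))"]
    unfolding K_def by (simp add: a)
  moreover have "s \<le> rlevel (- (a + (1 - \<epsilon>)))"
    using le rlevel_strict_mono_left[of "rleft s" "- (a + (1 - \<epsilon>))"] rleft[OF assms] a
    by (cases "rleft s = - (a + (1 - \<epsilon>))") auto
  ultimately show False by simp
qed

text \<open>The argument of \<open>branch_sum_upper\<close> with reversed signs: for half the shift
  the cubic at \<open>z\<close> exceeds the mirrored one by a polynomial in \<open>z\<close> with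
  nonnegative coefficients.\<close>

lemma branch_sum_lower:
  assumes "0 < s"
  shows "(1 - \<epsilon>) / 2 < - (rright s + rleft s)"
proof (rule ccontr)
  define a where "a = rright s"
  define \<eta> where "\<eta> = (1 - \<epsilon>) / 2"
  define K where "K = (\<lambda>z. ln (1 + rlevel (- (z + \<eta>))) - ln (1 + rlevel z))"
  have a: "\<epsilon> < a" "rlevel a = s" using rright[OF assms] by (auto simp: a_def)
  assume "\<not> ?thesis"
  then have le: "- (a + \<eta>) \<le> rleft s" by (simp add: a_def \<eta>_def field_simps)
  \<comment> \<open>For this smaller shift, it is the assumption made for contradiction that puts
    the mirror point on the left branch.\<close>
  then have a1: "1 < a + \<eta>" using rleft[OF assms] by simp
  have neg: "1 / rrate z + 1 / rrate (- (z + \<eta>)) < 0" if "a \<le> z" for z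
  proof -
    have z: "0 < z" "\<epsilon> < z" using that a eps_nonneg by auto
    have "rrate z - (- rrate (- (z + \<eta>))) = (\<eta> * z\<^sup>2 + \<eta>\<^sup>2 * z + \<eta> * (\<eta>\<^sup>2 + \<epsilon>)) / (1 + \<epsilon>)"
    proof -
      have e: "\<epsilon> = 1 - 2 * \<eta>" by (simp add: \<eta>_def field_simps)
      have "z * (z + 1) * (z - \<epsilon>) - (z + \<eta>) * (z + \<eta> - 1) * (z + \<eta> + \<epsilon>) =
        \<eta> * z\<^sup>2 + \<eta>\<^sup>2 * z + \<eta> * (\<eta>\<^sup>2 + \<epsilon>)"
        unfolding e by (simp add: power2_eq_square algebra_simps)
      then show ?thesis unfolding rrate_minus unfolding rrate_def by (simp add: diff_divide_distrib[symmetric])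
    qed
    also have "0 < \<dots>"
      using z eps_nonneg eps_less_1 by (intro divide_pos_pos add_pos_nonneg mult_pos_pos) (auto simp: \<eta>_def)
    finally have "- rrate (- (z + \<eta>)) < rrate z" by simp
    moreover have "0 < - rrate (- (z + \<eta>))"
      using rrate_neg[of "- (z + \<eta>)"] a1 that by simp
    ultimately have "1 / rrate z < 1 / - rrate (- (z + \<eta>))"
      by (intro divide_strict_left_mono mult_pos_pos) auto
    then show ?thesis by simp
  qed
  have der: "DERIV K z :> 1 / rrate z + 1 / rrate (- (z + \<eta>))" if "a \<le> z" for z
    using DERIV_minus[OF branch_comparison[of z \<eta>]] that a a1 by (simp add: K_def add.commute)
  have "(K \<longlongrightarrow> 0) at_top"
    using tendsto_minus[OF branch_comparison_tendsto[of \<eta>]] by (simp add: K_def)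
  from tendsto_0_decreasing_imp_pos[OF this der neg] have "0 < K a" by simp
  then have "s < rlevel (- (a + \<eta>))"
    using a a1 one_plus_rlevel_pos[of a] one_plus_rlevel_pos[of "- (a + \<eta>)"]
    unfolding K_def by (simp add: a)
  moreover have "rlevel (- (a + \<eta>)) \<le> s"
    using le rlevel_strict_mono_left[of "- (a + \<eta>)" "rleft s"] rleft[OF assms]
    by (cases "rleft s = - (a + \<eta>)") auto
  ultimately show False by simp
qed

section \<open>Distance of the branches, divided difference and weight\<close>

definition gap :: "real \<Rightarrow> real" where
  "gap s = rright s - rleft s"

text \<open>The divided difference of the cubic \<open>r (r + 1) (r - \<epsilon>)\<close> at the two branches.\<close>

definition cdiff :: "real \<Rightarrow> real" where
  "cdiff s = (rright s)\<^sup>2 + rright s * rleft s + (rleft s)\<^sup>2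
     + (1 - \<epsilon>) * (rright s + rleft s) - \<epsilon>"

lemma gap_pos: "0 < s \<Longrightarrow> 0 < gap s"
  using rright[of s] rleft[of s] eps_nonneg by (simp add: gap_def)

lemma cdiff_gt:
  assumes "0 < s"
  shows "0 < cdiff s" "(rright s)\<^sup>2 - 1 < cdiff s"
  using cubic_divided_difference_ineq(1)[OF eps_nonneg eps_less_1 rright(1) rleft(1)
      branch_sum_lower branch_sum_upper, OF assms assms assms assms]
  by (simp_all add: cdiff_def)

text \<open>The difference of the cubic at the two branches is \<open>gap\<close> times
  \<open>cdiff\<close>, so \<open>gap\<close> obeys a linear equation with rate given by
  \<open>cdiff\<close>.\<close>

lemma DERIV_gap:
  assumes "0 < s"
  shows "DERIV gap s :> - gap s * cdiff s / ((1 + \<epsilon>) * (1 + s))"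
proof -
  have "DERIV gap s :> - rrate (rright s) / (1 + s) - - rrate (rleft s) / (1 + s)"
    unfolding gap_def[abs_def] by (intro DERIV_diff DERIV_rright DERIV_rleft assms)
  moreover have "- rrate a / (1 + s) - - rrate l / (1 + s) =
      - (a - l) * (a\<^sup>2 + a * l + l\<^sup>2 + (1 - \<epsilon>) * (a + l) - \<epsilon>) / ((1 + \<epsilon>) * (1 + s))" for a l
    using assms eps_nonneg
    by (simp add: rrate_def divide_simps) (simp add: power2_eq_square algebra_simps)
  ultimately show ?thesis by (simp only: gap_def cdiff_def)
qed

lemma DERIV_cdiff:
  assumes "0 < s"
  defines "a \<equiv> rright s" and "l \<equiv> rleft s"
  shows "DERIV cdiff s :> ((2 * a + l + (1 - \<epsilon>)) * - rrate a + (2 * l + a + (1 - \<epsilon>)) * - rrate l) / (1 + s)"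
proof -
  have 1: "DERIV rright s :> - rrate a / (1 + s)" and 2: "DERIV rleft s :> - rrate l / (1 + s)"
    using DERIV_rright[OF assms(1)] DERIV_rleft[OF assms(1)] by (simp_all add: a_def l_def)
  show ?thesis unfolding cdiff_def[abs_def]
    by (rule derivative_eq_intros 1 2 refl)+
      (simp add: a_def l_def add_divide_distrib diff_divide_distrib algebra_simps)
qed

lemma rright_gt:
  assumes "\<epsilon> < n" "0 < s" "s < rlevel n"
  shows "n < rright s"
  using assms rright[of s] rlevel_strict_antimono_right[of "rright s" n]
  by (cases "rright s" n rule: linorder_cases) auto

text \<open>
  With \<open>G = (1 + \<epsilon>) / (2 * cdiff)\<close> the claim is \<open>G s < s\<close>. The function \<open>(s - G s) / (1 + s)\<close>
  vanishes at \<open>0\<close> and is strictly increasing by \<open>cubic_divided_difference_ineq\<close>.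
\<close>

lemma cdiff_lower:
  assumes "0 < s"
  shows "1 + \<epsilon> < 2 * cdiff s * s"
proof -
  define G where "G = (\<lambda>s. (1 + \<epsilon>) / (2 * cdiff s))"
  define Z where "Z = (\<lambda>s. (s - G s) / (1 + s))"
  have "\<exists>d>0. DERIV Z t :> d" if t: "0 < t" for t
  proof -
    define a where "a = rright t"
    define l where "l = rleft t"
    define D where "D = cdiff t"
    define D' where "D' = (2 * a + l + (1 - \<epsilon>)) * - rrate a + (2 * l + a + (1 - \<epsilon>)) * - rrate l"
    have D: "0 < D" using cdiff_gt[OF t] by (simp add: D_def)
    have dD: "DERIV cdiff t :> D' / (1 + t)"
      using DERIV_cdiff[OF t] by (simp add: D'_def a_def l_def)
    have r: "(1 + \<epsilon>) * rrate r = r * (r + 1) * (r - \<epsilon>)" for r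
      using eps_nonneg by (simp add: rrate_def)
    have "(1 + \<epsilon>) * D' = - ((2 * a + l + (1 - \<epsilon>)) * ((1 + \<epsilon>) * rrate a))
        - (2 * l + a + (1 - \<epsilon>)) * ((1 + \<epsilon>) * rrate l)"
      by (simp add: D'_def algebra_simps)
    note e = this[unfolded r]
    have pos: "0 < 2 * D\<^sup>2 + (1 + \<epsilon>) * D + (1 + \<epsilon>) * D'"
      using cubic_divided_difference_ineq(2)[OF eps_nonneg eps_less_1 rright(1) rleft(1)
          branch_sum_lower branch_sum_upper, OF t t t t] eps_nonneg
      unfolding e D_def cdiff_def a_def l_def by linarith
    have "DERIV G t :> (0 * (2 * cdiff t) - (1 + \<epsilon>) * (2 * (D' / (1 + t)))) / ((2 * cdiff t) * (2 * cdiff t))"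
      unfolding G_def using D by (intro DERIV_divide DERIV_const DERIV_cmult dD) (simp add: D_def)
    from DERIV_diff[OF DERIV_ident this]
    have "DERIV Z t :> ((1 - (0 * (2 * cdiff t) - (1 + \<epsilon>) * (2 * (D' / (1 + t)))) / ((2 * cdiff t) * (2 * cdiff t))) * (1 + t)
        - (t - G t) * (0 + 1)) / ((1 + t) * (1 + t))"
      unfolding Z_def using t by (intro DERIV_divide DERIV_add DERIV_const DERIV_ident) auto
    \<comment> \<open>Up to the positive factor 2 D^2, the numerator of the derivative is the
      quantity shown positive in \<open>pos\<close>.\<close>
    moreover have "((1 - (0 * (2 * cdiff t) - (1 + \<epsilon>) * (2 * (D' / (1 + t)))) / ((2 * cdiff t) * (2 * cdiff t))) * (1 + t)
        - (t - G t) * (0 + 1)) = (2 * D\<^sup>2 + (1 + \<epsilon>) * D + (1 + \<epsilon>) * D') / (2 * D\<^sup>2)"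
      unfolding G_def D_def[symmetric] using D t
      by (simp add: divide_simps power2_eq_square) (simp add: algebra_simps)
    moreover have "0 < (2 * D\<^sup>2 + (1 + \<epsilon>) * D + (1 + \<epsilon>) * D') / (2 * D\<^sup>2) / ((1 + t) * (1 + t))"
      using pos D t by (intro divide_pos_pos mult_pos_pos) auto
    ultimately show ?thesis by auto
  qed
  then obtain Z' where Z': "\<And>t. 0 < t \<Longrightarrow> 0 < Z' t" "\<And>t. 0 < t \<Longrightarrow> DERIV Z t :> Z' t" by metis
  have inc: "Z t < Z u" if "0 < t" "t < u" for t u
    by (rule DERIV_pos_imp_less[OF that(2), of Z Z']) (use Z' that in auto)
  \<comment> \<open>The branches have no value at \<open>s = 0\<close>, so the limit of
    \<open>Z\<close> there is replaced by a contradiction: close to 0, \<open>G\<close> is small and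
    \<open>Z\<close> at least \<open>- G\<close>, so a negative \<open>Z t\<close> would be below an
    earlier value.\<close>
  have nonneg: "0 \<le> Z t" if t: "0 < t" for t
  proof (rule ccontr)
    assume neg: "\<not> 0 \<le> Z t"
    \<comment> \<open>Chosen so that 1/(n - 1) < - Z t. For levels below \<open>rlevel n\<close> the
      right branch exceeds \<open>n\<close>, hence \<open>cdiff\<close> exceeds n - 1 and
      \<open>G\<close> is less than 1/(n - 1).\<close>
    define n where "n = 2 - 1 / Z t"
    have n2: "2 < n" using neg by (simp add: n_def divide_less_0_iff)
    then have n: "2 < n" "\<epsilon> < n" using eps_less_1 by auto
    define u where "u = min t (rlevel n) / 2"
    have u: "0 < u" "u < t" "u < rlevel n"
      using t rlevel_pos[of n] n by (auto simp: u_def min_def)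
    have "n < rright u" using rright_gt[OF n(2) u(1,3)] .
    then have "n * n < (rright u)\<^sup>2" using n unfolding power2_eq_square by (intro mult_strict_mono) auto
    moreover have "n * 1 \<le> n * n" using n by (intro mult_left_mono) auto
    ultimately have c: "n - 1 < cdiff u" using cdiff_gt[OF u(1)] by simp
    have "G u < 1 / (n - 1)"
      unfolding G_def using c n eps_less_1 eps_nonneg
      using mult_strict_mono[of "1 + \<epsilon>" 2 "n - 1" "cdiff u"] by (simp add: divide_simps)
    also have "\<dots> < - Z t"
    proof -
      have "1 < - Z t * (n - 1)" using neg by (simp add: n_def algebra_simps)
      then show ?thesis using n by (simp add: field_simps)
    qed
    finally have less: "Z t < - G u" by simp
    have "0 \<le> G u" unfolding G_def using cdiff_gt[OF u(1)] eps_nonneg by simp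
    then have "0 \<le> u * G u" using u by simp
    moreover have "- G u * (1 + u) = - G u - u * G u" by (simp add: algebra_simps)
    ultimately have "- G u * (1 + u) \<le> u - G u" using u by linarith
    then have "- G u \<le> Z u" unfolding Z_def using u by (simp add: pos_le_divide_eq)
    then show False using less inc[OF u(1,2)] by simp
  qed
  have "0 < Z s" using nonneg[of "s / 2"] inc[of "s / 2" s] assms by simp
  then have "G s < s" using assms by (simp add: Z_def zero_less_divide_iff)
  then show ?thesis
    using cdiff_gt[OF assms] by (simp add: G_def pos_divide_less_eq mult.commute)
qed

definition weight :: "real \<Rightarrow> real" where
  "weight s = gap s * sqrt (s / (1 + s))"

text \<open>The derivative of \<open>weight\<close>, arranged so that the factor made positive by
  \<open>cdiff_lower\<close> stands alone.\<close>

definition weight' :: "real \<Rightarrow> real" where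
  "weight' s = - weight s * (2 * cdiff s * s - (1 + \<epsilon>)) / (2 * (1 + \<epsilon>) * s * (1 + s))"

lemma weight_pos: "0 < s \<Longrightarrow> 0 < weight s"
  by (simp add: weight_def gap_pos)

lemma weight'_neg: "0 < s \<Longrightarrow> weight' s < 0"
  using weight_pos[of s] cdiff_lower[of s] eps_nonneg
  unfolding weight'_def by (intro divide_neg_pos) auto

lemma DERIV_weight:
  assumes "0 < s"
  shows "DERIV weight s :> weight' s"
proof -
  define q where "q = sqrt (s / (1 + s))"
  have q: "0 < q" "q\<^sup>2 = s / (1 + s)" using assms by (auto simp: q_def)
  have "DERIV (\<lambda>s. s / (1 + s)) s :> (1 * (1 + s) - s * (0 + 1)) / ((1 + s) * (1 + s))"
    using assms by (intro DERIV_divide DERIV_add DERIV_ident DERIV_const) auto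
  then have 1: "DERIV (\<lambda>s. s / (1 + s)) s :> 1 / ((1 + s) * (1 + s))" by simp
  have 2: "DERIV (\<lambda>s. sqrt (s / (1 + s))) s :> inverse q / 2 * (1 / ((1 + s) * (1 + s)))"
    using DERIV_chain2[OF DERIV_real_sqrt 1] assms by (simp add: q_def)
  have i: "inverse q = q * ((1 + s) / s)" using q assms by (simp add: field_simps power2_eq_square)
  have "DERIV weight s :> - gap s * cdiff s / ((1 + \<epsilon>) * (1 + s)) * q
      + inverse q / 2 * (1 / ((1 + s) * (1 + s))) * gap s"
    unfolding weight_def[abs_def] q_def[symmetric]
    using DERIV_mult[OF DERIV_gap[OF assms] 2] by (simp add: q_def)
  also have "- gap s * cdiff s / ((1 + \<epsilon>) * (1 + s)) * q
      + inverse q / 2 * (1 / ((1 + s) * (1 + s))) * gap s = weight' s"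
    unfolding i weight'_def weight_def q_def[symmetric] using assms eps_nonneg
    by (simp add: divide_simps) (simp add: algebra_simps)
  finally show ?thesis .
qed

text \<open>The well is at most quadratic near its bottom,
  \<open>level x \<le> C * x\<^sup>2\<close>, so \<open>rright s\<close> grows at most like the
  inverse square root of \<open>s\<close>.\<close>

lemma rright_sq_bounded:
  assumes "0 < S"
  shows "\<exists>C>0. \<forall>s. 0 < s \<longrightarrow> s \<le> S \<longrightarrow> (rright s)\<^sup>2 * s \<le> C"
proof -
  define X where "X = 1 / rright S"
  note r = rright[OF assms]
  have X: "0 < X" "\<epsilon> * X < 1" "level X = S"
    using r eps_nonneg recip_domain[of "rright S"] by (auto simp: X_def rlevel_def)
  \<comment> \<open>With this constant, the derivative of \<open>level\<close> on [0, X] is at most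
    the derivative 2 C y of the parabola.\<close>
  define C where "C = (1 + S) / (1 - \<epsilon> * X)"
  have C: "0 < C" using X assms by (simp add: C_def)
  have dom: "\<epsilon> * y \<le> \<epsilon> * X" "level y \<le> S" if y: "0 \<le> y" "y \<le> X" for y
  proof -
    show "\<epsilon> * y \<le> \<epsilon> * X" using mult_left_mono[OF y(2) eps_nonneg] .
    show "level y \<le> S"
    proof (cases "y = 0 \<or> y = X")
      case False
      then have "rright S < 1 / y" using y r eps_nonneg by (auto simp: X_def field_simps)
      from rlevel_strict_antimono_right[OF r(1) this] show ?thesis unfolding r(2) by (simp add: rlevel_def)
    qed (use X assms in auto)
  qed
  have bound: "level x \<le> C * x\<^sup>2" if x: "0 < x" "x \<le> X" for x
  proof -
    have "level x - C * x\<^sup>2 \<le> level 0 - C * 0\<^sup>2"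
    proof (rule DERIV_nonpos_imp_nonincreasing[of 0 x "\<lambda>x. level x - C * x\<^sup>2"])
      fix y assume y: "0 \<le> y" "y \<le> x"
      note d = dom[of y]
      have sq: "DERIV (\<lambda>x. x\<^sup>2) y :> 2 * y" by (auto intro!: derivative_eq_intros)
      have "DERIV (\<lambda>x. level x - C * x\<^sup>2) y :>
          (1 + level y) * ((1 + \<epsilon>) * y / ((1 + y) * (1 - \<epsilon> * y))) - C * (2 * y)"
        using X y x d by (intro DERIV_diff DERIV_level DERIV_cmult sq) auto
      moreover have "(1 + level y) * ((1 + \<epsilon>) * y / ((1 + y) * (1 - \<epsilon> * y))) \<le>
          (1 + S) * (2 * y / (1 * (1 - \<epsilon> * X)))"
        using X y x d eps_nonneg eps_less_1 assms
        by (intro mult_mono frac_le divide_nonneg_nonneg mult_nonneg_nonneg mult_right_mono mult_pos_pos) auto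
      moreover have "(1 + S) * (2 * y / (1 * (1 - \<epsilon> * X))) = C * (2 * y)" by (simp add: C_def)
      ultimately show "\<exists>d. DERIV (\<lambda>x. level x - C * x\<^sup>2) y :> d \<and> d \<le> 0" by fastforce
    qed (use x in auto)
    then show ?thesis by simp
  qed
  show ?thesis
  proof (intro exI[of _ C] conjI allI impI C)
    fix s assume s: "0 < s" "s \<le> S"
    note rs = rright[OF s(1)]
    have "rright S \<le> rright s"
      using rlevel_strict_antimono_right[of "rright s" "rright S"] rs r s by force
    then have "level (1 / rright s) \<le> C * (1 / rright s)\<^sup>2"
      using rs r eps_nonneg by (intro bound) (auto simp: X_def frac_le)
    then show "(rright s)\<^sup>2 * s \<le> C"
      using rs eps_nonneg by (simp add: rlevel_def[symmetric] power_divide field_simps)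
  qed
qed

subsection \<open>The period integral and the width of the well\<close>

lemma branch_bounds:
  assumes "0 < s"
  shows "gap s \<le> 2 * rright s + 1" "cdiff s \<le> 3 * (rright s)\<^sup>2 + 2"
proof -
  define a where "a = rright s"
  define b where "b = - rleft s"
  have a: "0 < a" and b: "1 < b" "b < a + (1 - \<epsilon>)" "a < b"
    using rright[OF assms] rleft[OF assms] branch_sum_upper[OF assms] branch_sum_lower[OF assms]
      eps_nonneg eps_less_1 by (auto simp: a_def b_def)
  have b': "b \<le> a + 1" using b eps_nonneg by simp
  then show "gap s \<le> 2 * rright s + 1" by (simp add: gap_def a_def b_def)
  have "0 \<le> a * b" "0 \<le> (1 - \<epsilon>) * (b - a)" using a b eps_less_1 by auto
  moreover have "cdiff s = a\<^sup>2 - a * b + b\<^sup>2 - (1 - \<epsilon>) * (b - a) - \<epsilon>"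
    by (simp add: cdiff_def a_def b_def algebra_simps)
  ultimately have "cdiff s \<le> a\<^sup>2 + b\<^sup>2" using eps_nonneg by linarith
  also have "\<dots> \<le> a\<^sup>2 + (a + 1)\<^sup>2" using b b' by (intro add_left_mono power_mono) auto
  also have "\<dots> \<le> 3 * a\<^sup>2 + 2" using zero_le_power2[of "a - 1"] by (simp add: power2_eq_square algebra_simps)
  finally show "cdiff s \<le> 3 * (rright s)\<^sup>2 + 2" by (simp add: a_def)
qed

text \<open>The factor \<open>s\<close> cancels the division by \<open>s\<close> in
  \<open>weight'\<close>, and the remaining terms are controlled by
  \<open>rright_sq_bounded\<close>. The bounds provide the majorants for \<open>period\<close> and
  its derivative.\<close>

lemma weight_bounded:
  assumes "0 < S"
  shows "\<exists>C. \<forall>s. 0 < s \<longrightarrow> s \<le> S \<longrightarrow> weight s \<le> C \<and> \<bar>s * weight' s\<bar> \<le> C"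
proof -
  obtain K where K: "0 < K" "\<And>s. 0 < s \<Longrightarrow> s \<le> S \<Longrightarrow> (rright s)\<^sup>2 * s \<le> K"
    using rright_sq_bounded[OF assms] by blast
  \<comment> \<open>The leading 1 ensures C \<le> C * C, so that a bound on the square of
    \<open>weight\<close> by \<open>C\<close> bounds \<open>weight\<close> itself.\<close>
  define C where "C = 1 + (8 * K + 2 * S)"
  define B where "B = 3 * K + 2 * S"
  have pos: "1 \<le> C" "0 \<le> B" using K assms by (auto simp: C_def B_def)
  have w: "weight s \<le> C" if s: "0 < s" "s \<le> S" for s
  proof -
    define a where "a = rright s"
    have a: "0 < a" using rright[OF s(1)] eps_nonneg by (simp add: a_def)
    have "(weight s)\<^sup>2 = (gap s)\<^sup>2 * (s / (1 + s))" using s by (simp add: weight_def power_mult_distrib)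
    also have "\<dots> \<le> (2 * a + 1)\<^sup>2 * s"
      using branch_bounds(1)[OF s(1)] gap_pos[OF s(1)] s
      by (intro mult_mono power_mono) (auto simp: a_def divide_le_eq mult_le_cancel_left1)
    also have "\<dots> \<le> (8 * a\<^sup>2 + 2) * s"
      using s zero_le_power2[of "2 * a - 1"]
      by (intro mult_right_mono) (auto simp: power2_eq_square algebra_simps)
    also have "\<dots> = 8 * (a\<^sup>2 * s) + 2 * s" by (simp add: algebra_simps)
    also have "\<dots> \<le> 8 * K + 2 * S" using K(2)[OF s] s by (simp add: a_def)
    also have "\<dots> \<le> C * 1" by (simp add: C_def)
    also have "\<dots> \<le> C * C" using pos by (intro mult_left_mono) auto
    finally have "(weight s)\<^sup>2 \<le> C\<^sup>2" by (simp add: power2_eq_square)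
    then show ?thesis by (rule power2_le_imp_le) (use pos in linarith)
  qed
  have w': "\<bar>s * weight' s\<bar> \<le> C * B" if s: "0 < s" "s \<le> S" for s
  proof -
    define a where "a = rright s"
    define n where "n = 2 * cdiff s * s - (1 + \<epsilon>)"
    have n: "0 < n" using cdiff_lower[OF s(1)] by (simp add: n_def)
    have "2 * cdiff s * s \<le> 2 * ((3 * a\<^sup>2 + 2) * s)"
      using branch_bounds(2)[OF s(1)] s by (simp add: a_def mult_right_mono)
    also have "\<dots> = 2 * (3 * (a\<^sup>2 * s) + 2 * s)" by (simp add: algebra_simps)
    also have "\<dots> \<le> 2 * B" using K(2)[OF s] s by (simp add: a_def B_def)
    finally have nB: "n \<le> 2 * B" using eps_nonneg by (simp add: n_def)
    have den: "2 \<le> 2 * (1 + \<epsilon>) * (1 + s)"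
      using mult_mono[of 1 "1 + \<epsilon>" 1 "1 + s"] s eps_nonneg unfolding mult.assoc by simp
    have "\<bar>s * weight' s\<bar> = weight s * n / (2 * (1 + \<epsilon>) * (1 + s))"
      using s weight_pos[OF s(1)] n eps_nonneg unfolding weight'_def n_def[symmetric]
      by (simp add: abs_mult)
    also have "\<dots> \<le> C * (2 * B) / 2"
      using w[OF s] weight_pos[OF s(1)] n nB den pos by (intro frac_le mult_mono) auto
    finally show ?thesis by simp
  qed
  have "weight s \<le> C + C * B \<and> \<bar>s * weight' s\<bar> \<le> C + C * B" if "0 < s" "s \<le> S" for s
    using w[OF that] w'[OF that] pos mult_nonneg_nonneg[of C B] by linarith
  then show ?thesis by blast
qed

lemma continuous_on_weight: "continuous_on {0<..} weight"
  by (intro continuous_at_imp_continuous_on ballI DERIV_isCont[OF DERIV_weight]) simp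

lemma continuous_on_branches: "continuous_on {0<..} rright" "continuous_on {0<..} rleft"
  by (intro continuous_at_imp_continuous_on ballI DERIV_isCont[OF DERIV_rright] DERIV_isCont[OF DERIV_rleft]; simp)+

lemma continuous_on_weight': "continuous_on {0<..} weight'"
  unfolding weight'_def[abs_def] cdiff_def using eps_nonneg
  by (intro continuous_intros continuous_on_weight continuous_on_branches) auto

lemma borel_measurable_scaled:
  assumes "0 < s" "continuous_on {0<..} g"
  shows "(\<lambda>t. g (s * t) * arcsine t) \<in> borel_measurable borel"
proof -
  have "continuous_on {0<..<1::real} (\<lambda>t. g (s * t))"
    using assms by (intro continuous_on_compose2[OF assms(2)] continuous_intros) auto
  then have "(\<lambda>t. indicator {0<..<1} t *\<^sub>R g (s * t)) \<in> borel_measurable borel"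
    by (intro borel_measurable_continuous_on_indicator) auto
  moreover have "arcsine \<in> borel_measurable borel" using integrable_arcsine by auto
  ultimately have "(\<lambda>t. (indicator {0<..<1} t *\<^sub>R g (s * t)) * arcsine t) \<in> borel_measurable borel"
    by (intro borel_measurable_times)
  moreover have "(\<lambda>t. (indicator {0<..<1} t *\<^sub>R g (s * t)) * arcsine t) = (\<lambda>t. g (s * t) * arcsine t)"
    by (auto simp: arcsine_def indicator_def)
  ultimately show ?thesis by simp
qed

lemma integrable_scaled:
  assumes "0 < s" "continuous_on {0<..} g" and b: "\<And>t. 0 < t \<Longrightarrow> t < 1 \<Longrightarrow> \<bar>g (s * t)\<bar> \<le> C"
  shows "integrable lborel (\<lambda>t. g (s * t) * arcsine t)"
proof (rule Bochner_Integration.integrable_bound)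
  show "integrable lborel (\<lambda>t. C * arcsine t)" using integrable_arcsine by simp
  show "(\<lambda>t. g (s * t) * arcsine t) \<in> borel_measurable lborel"
    using borel_measurable_scaled[OF assms(1,2)] by simp
  show "AE t in lborel. norm (g (s * t) * arcsine t) \<le> norm (C * arcsine t)"
  proof (rule AE_I2)
    fix t :: real
    show "norm (g (s * t) * arcsine t) \<le> norm (C * arcsine t)"
      using b[of t] by (cases "0 < t \<and> t < 1") (auto simp: arcsine_def abs_mult intro!: mult_right_mono divide_right_mono)
  qed
qed

lemma integrable_weight:
  assumes "0 < s"
  shows "integrable lborel (\<lambda>t. weight (s * t) * arcsine t)"
proof -
  obtain C where C: "\<And>u. 0 < u \<Longrightarrow> u \<le> s \<Longrightarrow> weight u \<le> C"
    using weight_bounded[OF assms] by blast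
  have "\<bar>weight (s * t)\<bar> \<le> C" if "0 < t" "t < 1" for t
    using C[of "s * t"] weight_pos[of "s * t"] that assms by (simp add: mult_left_le)
  then show ?thesis by (rule integrable_scaled[OF assms continuous_on_weight])
qed

definition period :: "real \<Rightarrow> real" where
  "period s = (\<integral>t. weight (s * t) * arcsine t \<partial>lborel)"

text \<open>Differentiation under the integral sign yields an integrand that is negative throughout
  (0, 1).\<close>

lemma period_decreasing:
  assumes s: "0 < s"
  shows "\<exists>d<0. DERIV period s :> d"
proof -
  obtain C where C: "\<And>u. 0 < u \<Longrightarrow> u \<le> 2 * s \<Longrightarrow> \<bar>u * weight' u\<bar> \<le> C"
    using weight_bounded[of "2 * s"] s by auto
  have ball: "s / 2 < y" "y < 2 * s" "0 < y" if "y \<in> ball s (s / 2)" for y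
    using that s by (auto simp: dist_real_def abs_real_def split: if_splits)
  have C0: "0 \<le> C" using C[of s] s by linarith
  \<comment> \<open>The available bound is on \<open>u * weight' u\<close> with
    \<open>u = y * t\<close>. Dividing by \<open>y\<close> is harmless, because the radius
    \<open>s / 2\<close> keeps \<open>y\<close> away from 0.\<close>
  have bd: "\<bar>t * weight' (y * t)\<bar> \<le> 2 * C / s" if y: "y \<in> ball s (s / 2)" and t: "0 < t" "t < 1" for y t
  proof -
    have "y * t \<le> 2 * s" using ball[OF y] t mult_left_le[of t y] by linarith
    then have "\<bar>(y * t) * weight' (y * t)\<bar> \<le> C" using ball[OF y] t by (intro C) auto
    then have "\<bar>t * weight' (y * t)\<bar> \<le> C / y" using ball[OF y] by (simp add: abs_mult field_simps)
    also have "\<dots> \<le> C / (s / 2)" using ball[OF y] s C0 by (intro divide_left_mono) auto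
    finally show ?thesis by (simp add: mult.commute)
  qed
  have int': "integrable lborel (\<lambda>t. t * weight' (s * t) * arcsine t)"
  proof -
    have cont: "continuous_on {0<..} (\<lambda>u. u / s * weight' u)"
      using s by (intro continuous_intros continuous_on_weight') auto
    have "integrable lborel (\<lambda>t. (s * t) / s * weight' (s * t) * arcsine t)"
      by (rule integrable_scaled[OF s cont]) (use bd[of s] s in simp)
    then show ?thesis using s by simp
  qed
  have "DERIV period s :> (\<integral>t. t * weight' (s * t) * arcsine t \<partial>lborel)"
    unfolding period_def[abs_def]
  proof (rule has_real_derivative_integral[of "s / 2" s lborel "\<lambda>y t. weight (y * t) * arcsine t"
        "\<lambda>y t. t * weight' (y * t) * arcsine t" "\<lambda>t. 2 * C / s * arcsine t"])
    fix y t assume y: "y \<in> ball s (s / 2)"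
    show "integrable lborel (\<lambda>t. weight (y * t) * arcsine t)"
      using ball[OF y] by (intro integrable_weight) auto
    show "DERIV (\<lambda>y. weight (y * t) * arcsine t) y :> t * weight' (y * t) * arcsine t"
    proof (cases "0 < t \<and> t < 1")
      case True
      have "DERIV (\<lambda>y. y * t) y :> t" by (auto intro!: derivative_eq_intros)
      with True ball[OF y] have "DERIV (\<lambda>y. weight (y * t)) y :> weight' (y * t) * t"
        by (intro DERIV_chain2[OF DERIV_weight]) auto
      from DERIV_cmult_right[OF this, of "arcsine t"] show ?thesis by (simp add: mult_ac)
    qed (auto simp: arcsine_def)
    show "\<bar>t * weight' (y * t) * arcsine t\<bar> \<le> 2 * C / s * arcsine t"
    proof (cases "0 < t \<and> t < 1")
      case True
      then show ?thesis
        using mult_right_mono[OF bd[OF y, of t] arcsine_nonneg[of t]] arcsine_nonneg[of t]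
        by (simp add: abs_mult)
    qed (auto simp: arcsine_def)
  qed (use s integrable_arcsine int' in auto)
  moreover have "(\<integral>t. t * weight' (s * t) * arcsine t \<partial>lborel) < 0"
  proof (rule ccontr)
    let ?f = "\<lambda>t. - (t * weight' (s * t) * arcsine t)"
    assume "\<not> ?thesis"
    then have le: "(\<integral>t. ?f t \<partial>lborel) \<le> 0" by simp
    have pos: "0 < ?f t" if "0 < t" "t < 1" for t
    proof -
      have "0 < arcsine t" using that by (simp add: arcsine_def)
      with weight'_neg[of "s * t"] that s show ?thesis
        by (simp add: mult_less_0_iff zero_less_mult_iff)
    qed
    have nonneg: "0 \<le> ?f t" for t
      using pos[of t] by (cases "0 < t \<and> t < 1") (auto simp: arcsine_def)
    have "0 \<le> (\<integral>t. ?f t \<partial>lborel)" by (rule Bochner_Integration.integral_nonneg[OF nonneg])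
    \<comment> \<open>If the integral vanished, the integrand would be 0 almost everywhere, and the
      interval (0, 1) would be a null set.\<close>
    with le have "(\<integral>t. ?f t \<partial>lborel) = 0" by linarith
    then have "AE t in lborel. ?f t = 0"
      using integral_nonneg_eq_0_iff_AE[of lborel ?f] int' nonneg by simp
    then have "AE t in lborel. t \<notin> {0<..<1::real}"
      by (rule AE_mp) (use pos in \<open>intro AE_I2 impI notI; force\<close>)
    then have "{0<..<1::real} \<in> null_sets lborel" by (subst AE_iff_null_sets) auto
    then show False by (simp add: null_sets_def)
  qed
  ultimately show ?thesis by auto
qed

section \<open>Width of the well: \<open>q\<close> times the logarithm of the ratio of the apsidal
  distances\<close>

definition width :: "real \<Rightarrow> real" where
  "width s = dlog (1 / rright s) - dlog (1 / rleft s)"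

text \<open>The chain rule cancels the factors \<rho> and \<rho> - \<epsilon> of the cubic and
  leaves \<rho> + 1, so that the derivative of \<open>width\<close> involves only
  \<open>gap\<close>.\<close>

lemma DERIV_dlog_branch:
  assumes r: "\<epsilon> < \<rho> s \<or> \<rho> s < -1" and der: "DERIV \<rho> s :> - rrate (\<rho> s) / (1 + s)" and s: "0 < s"
  shows "DERIV (\<lambda>s. dlog (1 / \<rho> s)) s :> (\<rho> s + 1) / ((1 + \<epsilon>) * (1 + s))"
proof -
  note d = recip_domain[OF r]
  have n: "\<rho> s - \<epsilon> \<noteq> 0" using r eps_nonneg eps_less_1 by auto
  have "DERIV (\<lambda>s. 1 / \<rho> s) s :> (0 * \<rho> s - 1 * (- rrate (\<rho> s) / (1 + s))) / (\<rho> s * \<rho> s)"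
    using d by (intro DERIV_divide DERIV_const der) auto
  from DERIV_chain2[OF DERIV_dlog[OF d(2)] this]
  have "DERIV (\<lambda>s. dlog (1 / \<rho> s)) s :> 1 / (1 - \<epsilon> * (1 / \<rho> s)) * ((0 * \<rho> s - 1 * (- rrate (\<rho> s) / (1 + s))) / (\<rho> s * \<rho> s))" .
  moreover have "1 / (1 - \<epsilon> * (1 / r)) * ((0 * r - 1 * (- rrate r / (1 + s))) / (r * r)) = (r + 1) / ((1 + \<epsilon>) * (1 + s))"
    if "r \<noteq> 0" "r - \<epsilon> \<noteq> 0" for r
  proof -
    have "1 - \<epsilon> * (1 / r) = (r - \<epsilon>) / r" using that by (simp add: field_simps)
    then show ?thesis unfolding rrate_def using that s eps_nonneg by simp
  qed
  ultimately show ?thesis using d n by metis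
qed

lemma DERIV_width:
  assumes "0 < s"
  shows "DERIV width s :> gap s / ((1 + \<epsilon>) * (1 + s))"
proof -
  have "DERIV width s :> (rright s + 1) / ((1 + \<epsilon>) * (1 + s)) - (rleft s + 1) / ((1 + \<epsilon>) * (1 + s))"
    unfolding width_def[abs_def] using assms rright[OF assms] rleft[OF assms]
    by (intro DERIV_diff DERIV_dlog_branch DERIV_rright DERIV_rleft) auto
  then show ?thesis by (simp add: gap_def diff_divide_distrib[symmetric])
qed

lemma width_strict_mono:
  assumes "0 < s" "s < t"
  shows "width s < width t"
  by (rule DERIV_pos_imp_less[OF assms(2), of width "\<lambda>s. gap s / ((1 + \<epsilon>) * (1 + s))"])
    (use assms DERIV_width gap_pos eps_nonneg in auto)

lemma dlog_branch_eq: "-1 < x \<Longrightarrow> dlog x = ln (1 + level x) + ln (1 + x)"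
  by (simp add: level_def ln_div)

lemma dlog_rleft_neg: "0 < s \<Longrightarrow> dlog (1 / rleft s) < 0"
  using dlog_strict_mono[of "1 / rleft s" 0] rleft[of s] by simp

text \<open>Intermediate values: \<open>width s\<close> is at least \<open>ln (1 + s)\<close>, and
  it becomes arbitrarily small as \<open>s\<close> does.\<close>

lemma width_surj:
  assumes "0 < w"
  shows "\<exists>s>0. width s = w"
proof -
  have "ln (1 + s) \<le> width s" if s: "0 < s" for s
  proof -
    note r = rright[OF s]
    have "dlog (1 / rright s) = ln (1 + s) + ln (1 + 1 / rright s)"
      using dlog_branch_eq[of "1 / rright s"] r recip_domain[of "rright s"] by (simp add: rlevel_def)
    moreover have "0 \<le> ln (1 + 1 / rright s)" using r eps_nonneg by simp
    ultimately show ?thesis using dlog_rleft_neg[OF s] by (simp add: width_def)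
  qed
  from this[of "exp w - 1"] have up: "w \<le> width (exp w - 1)" using assms by simp
  have lo: "\<exists>s. 0 < s \<and> s < exp w - 1 \<and> width s < w"
  proof -
    \<comment> \<open>For small \<open>s\<close> the width is less than s + 1/a + 1/a, where
      \<open>a\<close> is the right branch. The choices of \<open>n\<close> and \<open>m\<close>
      make each summand less than w/4.\<close>
    define n where "n = 1 + 4 / w"
    have n: "\<epsilon> < n" "1 < n" using assms eps_less_1 by (auto simp: n_def intro: add_pos_pos less_trans)
    define m where "m = min (min (exp w - 1) (rlevel n)) (w / 4)"
    define s where "s = m / 2"
    have p: "0 < m" "m \<le> exp w - 1" "m \<le> rlevel n" "m \<le> w / 4"
      using assms rlevel_pos[of n] n unfolding m_def
      by (simp_all only: min_less_iff_conj min.cobounded1 min.cobounded2 min.coboundedI1) auto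
    have s: "0 < s" "s < exp w - 1" "s < rlevel n" "s < w / 4"
      using p unfolding s_def by linarith+
    define a where "a = rright s"
    have a: "n < a" using rright_gt[OF n(1) s(1,3)] by (simp add: a_def)
    have "1 / a < 1 / n" using a n by (intro divide_strict_left_mono mult_pos_pos) auto
    also have "\<dots> < w / 4" using assms by (simp add: n_def field_simps)
    finally have a1: "1 / a < w / 4" .
    have "dlog (1 / a) = ln (1 + s) + ln (1 + 1 / a)"
      using dlog_branch_eq[of "1 / a"] rright[OF s(1)] recip_domain[of a] by (simp add: rlevel_def a_def)
    moreover have "ln (1 + s) \<le> s" using s by (intro ln_add_one_self_le_self) auto
    moreover have "ln (1 + 1 / a) \<le> 1 / a" using a n by (intro ln_add_one_self_le_self) auto
    moreover have "- dlog (1 / rleft s) < 1 / a"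
    proof -
      define b where "b = - rleft s"
      have b: "a < b" using branch_sum_lower[OF s(1)] eps_less_1 by (simp add: a_def b_def)
      have "- (1 / b) \<le> dlog (1 / rleft s)"
        using dlog_ge[of "1 / rleft s"] recip_domain[of "rleft s"] rleft[OF s(1)] by (simp add: b_def)
      moreover have "1 / b < 1 / a" using a b n by (intro divide_strict_left_mono mult_pos_pos) auto
      ultimately show ?thesis by simp
    qed
    ultimately have "width s < w" using a1 s by (simp add: width_def a_def)
    then show ?thesis using s by blast
  qed
  then obtain s where s: "0 < s" "s < exp w - 1" "width s < w" by blast
  have "continuous_on {s..exp w - 1} width"
    using s by (intro continuous_at_imp_continuous_on ballI DERIV_isCont[OF DERIV_width]) auto
  then have "\<exists>x\<ge>s. x \<le> exp w - 1 \<and> width x = w"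
    using s up by (intro IVT') auto
  then obtain x where "s \<le> x" "width x = w" by blast
  then show ?thesis using s by (intro exI[of _ x]) simp
qed

definition width_inv :: "real \<Rightarrow> real" where
  "width_inv w = (THE s. 0 < s \<and> width s = w)"

lemma width_inj:
  assumes "0 < s" "0 < t" "width s = width t"
  shows "s = t"
  using assms width_strict_mono[of s t] width_strict_mono[of t s]
  by (cases s t rule: linorder_cases) auto

lemma width_inv:
  assumes "0 < w"
  shows "0 < width_inv w" "width (width_inv w) = w"
proof -
  have "\<exists>!s. 0 < s \<and> width s = w" using width_surj[OF assms] by (auto intro: width_inj)
  from theI'[OF this] show "0 < width_inv w" "width (width_inv w) = w"
    by (auto simp: width_inv_def)
qed

lemma width_pos:
  assumes "0 < s"
  shows "0 < width s"
  using dlog_rleft_neg[OF assms] dlog_strict_mono[of 0 "1 / rright s"] rright[OF assms]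
    recip_domain[of "rright s"] eps_nonneg by (simp add: width_def)

lemma width_inv_width: "0 < s \<Longrightarrow> width_inv (width s) = s"
  by (rule width_inj) (auto intro!: width_inv width_pos)

lemma DERIV_width_inv:
  assumes "0 < w"
  shows "\<exists>d>0. DERIV width_inv w :> d"
proof -
  define s where "s = width_inv w"
  note i = width_inv[OF assms]
  have p: "0 < gap s / ((1 + \<epsilon>) * (1 + s))"
    using gap_pos[of s] i eps_nonneg by (simp add: s_def)
  have "DERIV width_inv w :> inverse (gap (width_inv w) / ((1 + \<epsilon>) * (1 + width_inv w)))"
  proof (rule DERIV_inverse_function_open[where S = "{0<..}" and f = width])
    fix z :: real assume "z \<in> {0<..}"
    then show "DERIV width z :> gap z / ((1 + \<epsilon>) * (1 + z))" "width_inv (width z) = z"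
      by (simp_all add: DERIV_width width_inv_width)
  qed (use i p in \<open>auto simp: s_def\<close>)
  with p show ?thesis unfolding s_def by (metis positive_imp_inverse_positive)
qed

section \<open>The inverse of \<open>dlog\<close> and the sign of the radial profile\<close>

definition dexp :: "real \<Rightarrow> real" where
  "dexp y = (if \<epsilon> = 0 then y else (1 - exp (- \<epsilon> * y)) / \<epsilon>)"

lemma dexp_dom: "\<epsilon> * dexp y < 1"
  by (simp add: dexp_def)

lemma dlog_dexp [simp]: "dlog (dexp y) = y"
  by (simp add: dlog_def dexp_def)

lemma dlog_inj:
  assumes "\<epsilon> * x < 1" "\<epsilon> * y < 1" "dlog x = dlog y"
  shows "x = y"
  using assms dlog_strict_mono[of x y] dlog_strict_mono[of y x]
  by (cases x y rule: linorder_cases) auto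

lemma dexp_dlog: "\<epsilon> * x < 1 \<Longrightarrow> dexp (dlog x) = x"
  by (rule dlog_inj) (auto simp: dexp_dom)

lemma dexp_strict_mono:
  assumes "y < z"
  shows "dexp y < dexp z"
proof (rule ccontr)
  assume "\<not> dexp y < dexp z"
  then have "dlog (dexp z) \<le> dlog (dexp y)"
    using dlog_strict_mono[of "dexp z" "dexp y"] dexp_dom[of y] by (cases "dexp z = dexp y") auto
  then show False using assms by simp
qed

lemma dexp_0 [simp]: "dexp 0 = 0"
  by (simp add: dexp_def)

lemma dexp_less_iff: "dexp y < dexp z \<longleftrightarrow> y < z"
  using dexp_strict_mono[of y z] dexp_strict_mono[of z y] by (cases y z rule: linorder_cases) auto

lemma rleft_less:
  assumes "0 < u" "u < s"
  shows "rleft u < rleft s"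
proof -
  have s: "0 < s" using assms by simp
  have "rlevel (rleft u) < rlevel (rleft s)" using rleft(2)[OF assms(1)] rleft(2)[OF s] assms by linarith
  then have "\<not> rleft s < rleft u" "rleft u \<noteq> rleft s"
    using rlevel_strict_mono_left[of "rleft s" "rleft u"] rleft(1)[OF assms(1)] by auto
  then show ?thesis by linarith
qed

text \<open>For x > -1 the profile \<open>exp (- dlog x) * (1 + x)\<close> equals
  \<open>1 / (1 + level x)\<close>, so both claims compare \<open>level x\<close> with
  \<open>s\<close>, one side of the well at a time. For x \<le> -1 it is not positive.\<close>

lemma profile_gt_iff:
  assumes s: "0 < s" and x: "\<epsilon> * x < 1"
  shows "1 < (1 + s) * (exp (- dlog x) * (1 + x)) \<longleftrightarrow> 1 / rleft s < x \<and> x < 1 / rright s" (is ?gt)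
    and "(1 + s) * (exp (- dlog x) * (1 + x)) = 1 \<longleftrightarrow> x = 1 / rleft s \<or> x = 1 / rright s" (is ?eq)
proof -
  define a where "a = rright s"
  define l where "l = rleft s"
  have a: "0 < a" "\<epsilon> < a" "rlevel a = s" and l: "l < -1" "rlevel l = s"
    using rright[OF s] rleft[OF s] eps_nonneg by (auto simp: a_def l_def)
  have l1: "-1 < 1 / l" "1 / l < 0" using l by (auto simp: field_simps)
  have "?gt \<and> ?eq"
  proof (cases "-1 < x")
    case False
    then have "(1 + s) * (exp (- dlog x) * (1 + x)) \<le> 0"
      using s by (intro mult_nonneg_nonpos) auto
    moreover have "0 < 1 / a" using a by simp
    then have "x \<noteq> 1 / a" using False by linarith
    ultimately show ?thesis using False l1 by (auto simp: a_def[symmetric] l_def[symmetric])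
  next
    case True
    have "exp (- dlog x) * (1 + x) = 1 / (1 + level x)"
      using True by (simp add: level_def exp_minus field_simps)
    then have e: "(1 + s) * (exp (- dlog x) * (1 + x)) = (1 + s) / (1 + level x)" by simp
    have p: "0 < 1 + level x" using one_plus_level_pos[OF True] .
    have "(1 < (1 + s) * (exp (- dlog x) * (1 + x)) \<longleftrightarrow> level x < s) \<and>
        ((1 + s) * (exp (- dlog x) * (1 + x)) = 1 \<longleftrightarrow> level x = s)"
      unfolding e using p by (auto simp: field_simps)
    moreover have "(level x < s \<longleftrightarrow> 1 / l < x \<and> x < 1 / a) \<and> (level x = s \<longleftrightarrow> x = 1 / l \<or> x = 1 / a)"
    proof (cases x "0::real" rule: linorder_cases)
      case equal
      then show ?thesis using s l1 a by auto
    next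
      case greater
      then have r: "\<epsilon> < 1 / x" "rlevel (1 / x) = level x" using x by (auto simp: rlevel_def field_simps)
      have "level x < s \<longleftrightarrow> a < 1 / x" "level x = s \<longleftrightarrow> a = 1 / x"
        using r a rlevel_strict_antimono_right[of a "1/x"] rlevel_strict_antimono_right[of "1/x" a]
        by (cases a "1/x" rule: linorder_cases; force)+
      moreover have "a < 1 / x \<longleftrightarrow> x < 1 / a" "a = 1 / x \<longleftrightarrow> x = 1 / a"
        using greater a by (auto simp: field_simps)
      moreover have "1 / l < x" using greater l1 by linarith
      ultimately show ?thesis by auto
    next
      case less
      then have r: "1 / x < -1" "rlevel (1 / x) = level x" using True by (auto simp: rlevel_def field_simps)
      have "level x < s \<longleftrightarrow> 1 / x < l" "level x = s \<longleftrightarrow> l = 1 / x"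
        using r l rlevel_strict_mono_left[of l "1/x"] rlevel_strict_mono_left[of "1/x" l]
        by (cases l "1/x" rule: linorder_cases; force)+
      moreover have "1 / x < l \<longleftrightarrow> 1 / l < x" "l = 1 / x \<longleftrightarrow> x = 1 / l"
        using less l by (auto simp: field_simps)
      moreover have "x < 1 / a" "x \<noteq> 1 / a" using less a by (auto intro: less_trans[of _ 0])
      ultimately show ?thesis by auto
    qed
    ultimately show ?thesis by (simp add: a_def[symmetric] l_def[symmetric])
  qed
  then show ?gt ?eq by auto
qed

end

subsection \<open>Orbits\<close>

locale power_law =
  fixes \<alpha> :: real
  assumes alpha_gt: "-2 < \<alpha>" and alpha_less: "\<alpha> < 1"
begin

definition eps :: real where
  "eps = (if 0 < \<alpha> then \<alpha> / (2 - \<alpha>) else - \<alpha> / 2)"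

definition q :: real where
  "q = (if 0 < \<alpha> then 2 - \<alpha> else 2)"

lemma q_pos: "0 < q"
  using alpha_less by (simp add: q_def)

sublocale power_well eps
  by unfold_locales (use alpha_gt alpha_less in \<open>auto simp: eps_def field_simps\<close>)

text \<open>The value of \<open>2 * r\<^sup>2 * (E + V r) / l\<^sup>2\<close> at
  \<open>r = r0\<close> when \<open>E = energy r0\<close>. The radial velocity squared is positive
  there exactly if this exceeds 1.\<close>

definition peak :: "real \<Rightarrow> real \<Rightarrow> real" where
  "peak r0 l = r0 powr (2 - \<alpha>) / l\<^sup>2"

text \<open>The energy for which \<open>r0\<close> is a critical point of
  \<open>r\<^sup>2 * (E + V r)\<close>.\<close>

definition energy :: "real \<Rightarrow> real" where
  "energy r0 = r0 powr (- \<alpha>) / 2 - V \<alpha> r0"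

text \<open>The coordinate \<open>x\<close> of the well. It decreases in \<open>r\<close>: radii
  inside \<open>r0\<close> lie on the right side, radii outside on the left.\<close>

definition coord :: "real \<Rightarrow> real \<Rightarrow> real" where
  "coord r0 r = dexp (q * ln (r0 / r))"

text \<open>This explains \<open>q\<close> and \<open>eps\<close>. Splitting off the power of
  \<open>r\<close> with exponent 2 - \<alpha> for \<alpha> > 0, and 2 otherwise, leaves an affine
  function of a power of \<open>r\<close>, or of its logarithm, which \<open>coord\<close>
  normalises to 1 + x.\<close>

lemma effective_profile:
  assumes r0: "0 < r0" and r: "0 < r"
  shows "2 * r\<^sup>2 * (energy r0 + V \<alpha> r) =
    r0 powr (2 - \<alpha>) * (exp (- (q * ln (r0 / r))) * (1 + coord r0 r))"
proof -
  define A where "A = r powr \<alpha>"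
  define B where "B = r0 powr \<alpha>"
  have AB: "0 < A" "0 < B" using r r0 by (auto simp: A_def B_def)
  have B2: "r0 powr (2 - \<alpha>) = r0\<^sup>2 / B" "r0 powr (- \<alpha>) = 1 / B"
    using r0 by (simp_all add: powr_diff powr_minus B_def inverse_eq_divide)
  have e: "exp (c * ln (r0 / r)) = (r0 / r) powr c" for c
    using r r0 by (simp add: powr_def)
  have e2: "exp (- (2 * ln (r0 / r))) = r\<^sup>2 / r0\<^sup>2"
    using e[of "-2"] r r0 by (simp add: powr_minus power_divide)
  have ea: "exp (\<alpha> * ln (r0 / r)) = B / A"
    using e[of \<alpha>] r r0 by (simp add: powr_divide A_def B_def)
  consider "\<alpha> = 0" | "0 < \<alpha>" | "\<alpha> < 0" by linarith
  then show ?thesis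
  proof cases
    case 1
    have q: "eps = 0" "q = 2" unfolding eps_def q_def using 1 by simp_all
    have p: "exp (- (q * ln (r0 / r))) * (1 + coord r0 r) = r\<^sup>2 / r0\<^sup>2 * (1 + 2 * (ln r0 - ln r))"
      unfolding coord_def dexp_def unfolding q e2 using r r0 by (simp add: ln_div)
    show ?thesis
      unfolding p energy_def V_def using 1 r r0 by (simp add: field_simps)
  next
    case 2
    have q: "q = 2 - \<alpha>" "eps * q = \<alpha>" "eps \<noteq> 0" using 2 alpha_less by (auto simp: q_def eps_def)
    have m: "- eps * (q * ln (r0 / r)) = - (\<alpha> * ln (r0 / r))"
      by (simp add: q(2) mult.assoc[symmetric])
    have c: "coord r0 r = (1 - A / B) / eps"
      unfolding coord_def dexp_def m using q(3) by (simp add: exp_minus ea)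
    have "exp (- (q * ln (r0 / r))) = exp (- (2 * ln (r0 / r))) * exp (\<alpha> * ln (r0 / r))"
      by (simp add: q(1) exp_add[symmetric] algebra_simps)
    then have p: "exp (- (q * ln (r0 / r))) = r\<^sup>2 / r0\<^sup>2 * (B / A)" by (simp only: e2 ea)
    show ?thesis
      unfolding p c B2 energy_def V_def A_def[symmetric] B_def[symmetric]
      using 2 r r0 AB alpha_less by (simp add: eps_def field_simps)
  next
    case 3
    have q: "q = 2" "eps * q = - \<alpha>" "eps \<noteq> 0" using 3 by (auto simp: q_def eps_def)
    have m: "- eps * (q * ln (r0 / r)) = \<alpha> * ln (r0 / r)"
      by (simp add: q(2) mult.assoc[symmetric])
    have c: "coord r0 r = (1 - B / A) / eps"
      unfolding coord_def dexp_def m using q(3) by (simp add: ea)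
    have p: "exp (- (q * ln (r0 / r))) = r\<^sup>2 / r0\<^sup>2" by (simp add: q(1) e2)
    show ?thesis
      unfolding p c B2 energy_def V_def A_def[symmetric] B_def[symmetric]
      using 3 r r0 AB by (simp add: eps_def field_simps)
  qed
qed

lemma radial_profile:
  assumes "0 < r0" "0 < r" "0 < l"
  shows "r\<^sup>2 * radial \<alpha> (energy r0) l r / l\<^sup>2 =
    peak r0 l * (exp (- dlog (coord r0 r)) * (1 + coord r0 r)) - 1"
proof -
  have "r\<^sup>2 * radial \<alpha> (energy r0) l r = 2 * r\<^sup>2 * (energy r0 + V \<alpha> r) - l\<^sup>2"
    using assms by (simp add: radial_def algebra_simps)
  then show ?thesis
    using assms by (simp add: effective_profile coord_def peak_def diff_divide_distrib)
qed

definition apsis :: "real \<Rightarrow> real \<Rightarrow> real" where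
  "apsis r0 \<rho> = r0 * exp (- dlog (1 / \<rho>) / q)"

lemma apsis_pos: "0 < r0 \<Longrightarrow> 0 < apsis r0 \<rho>"
  by (simp add: apsis_def)

lemma coord_dom: "eps * coord r0 r < 1"
  by (simp add: coord_def dexp_dom)

lemma coord_apsis:
  assumes "0 < r0" "eps < \<rho> \<or> \<rho> < -1"
  shows "coord r0 (apsis r0 \<rho>) = 1 / \<rho>"
proof -
  have "ln (r0 / apsis r0 \<rho>) = dlog (1 / \<rho>) / q"
    using assms by (simp add: apsis_def ln_div ln_mult)
  then show ?thesis
    using q_pos recip_domain[OF assms(2)] by (simp add: coord_def dexp_dlog)
qed

lemma coord_less_iff:
  assumes "0 < r0" "0 < r" "0 < r'"
  shows "coord r0 r < coord r0 r' \<longleftrightarrow> r' < r"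
  using assms q_pos by (simp add: coord_def dexp_less_iff ln_div)

lemma coord_eq_iff:
  assumes "0 < r0" "0 < r" "0 < r'"
  shows "coord r0 r = coord r0 r' \<longleftrightarrow> r = r'"
  using coord_less_iff[OF assms] coord_less_iff[OF assms(1,3,2)]
  by (cases r r' rule: linorder_cases) auto

lemma coord_center: "0 < r0 \<Longrightarrow> coord r0 r0 = 0"
  by (simp add: coord_def)

section \<open>Orbits with prescribed centre and peak: apsides, eccentricity and angle\<close>

context
  fixes r0 l s :: real
  assumes r0: "0 < r0" and l: "0 < l" and s: "0 < s" and peak: "peak r0 l = 1 + s"
begin

lemma radial_sign:
  assumes r: "0 < r"
  shows "0 < radial \<alpha> (energy r0) l r \<longleftrightarrow> apsis r0 (rright s) < r \<and> r < apsis r0 (rleft s)"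
    and "radial \<alpha> (energy r0) l r = 0 \<longleftrightarrow> r = apsis r0 (rright s) \<or> r = apsis r0 (rleft s)"
proof -
  let ?R = "radial \<alpha> (energy r0) l r" and ?x = "coord r0 r"
  have e: "r\<^sup>2 * ?R / l\<^sup>2 = (1 + s) * (exp (- dlog ?x) * (1 + ?x)) - 1"
    using radial_profile[OF r0 r l] by (simp add: peak)
  have p: "0 < r\<^sup>2 / l\<^sup>2" using r l by simp
  have "0 < ?R \<longleftrightarrow> 0 < r\<^sup>2 / l\<^sup>2 * ?R" using p by (simp only: zero_less_mult_iff) auto
  then have 1: "0 < ?R \<longleftrightarrow> 1 < (1 + s) * (exp (- dlog ?x) * (1 + ?x))" using e by simp
  have "?R = 0 \<longleftrightarrow> r\<^sup>2 / l\<^sup>2 * ?R = 0" using p by (simp only: mult_eq_0_iff) auto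
  then have 2: "?R = 0 \<longleftrightarrow> (1 + s) * (exp (- dlog ?x) * (1 + ?x)) = 1" using e by simp
  have ca: "coord r0 (apsis r0 (rright s)) = 1 / rright s" "coord r0 (apsis r0 (rleft s)) = 1 / rleft s"
    using rright[OF s] rleft[OF s] r0 by (auto intro!: coord_apsis)
  note ap = apsis_pos[OF r0]
  show "0 < ?R \<longleftrightarrow> apsis r0 (rright s) < r \<and> r < apsis r0 (rleft s)"
    unfolding 1 profile_gt_iff(1)[OF s coord_dom] ca[symmetric]
    using r r0 ap by (auto simp: coord_less_iff)
  show "?R = 0 \<longleftrightarrow> r = apsis r0 (rright s) \<or> r = apsis r0 (rleft s)"
    unfolding 2 profile_gt_iff(2)[OF s coord_dom] ca[symmetric]
    using r r0 ap by (auto simp: coord_eq_iff)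
qed

lemma apsis_order: "apsis r0 (rright s) < r0" "r0 < apsis r0 (rleft s)"
proof -
  have "0 < 1 / rright s" "1 / rleft s < 0"
    using rright[OF s] rleft[OF s] eps_nonneg by auto
  then have "coord r0 r0 < coord r0 (apsis r0 (rright s))" "coord r0 (apsis r0 (rleft s)) < coord r0 r0"
    using rright[OF s] rleft[OF s] r0 by (simp_all add: coord_apsis coord_center)
  then show "apsis r0 (rright s) < r0" "r0 < apsis r0 (rleft s)"
    unfolding coord_less_iff[OF r0 r0 apsis_pos[OF r0]] coord_less_iff[OF r0 apsis_pos[OF r0] r0] .
qed

lemma bounded_orbit_apsis:
  "bounded_orbit \<alpha> (energy r0) l (apsis r0 (rright s)) (apsis r0 (rleft s))"
  unfolding bounded_orbit_def
proof (intro conjI ballI)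
  show "0 < apsis r0 (rright s)" by (rule apsis_pos[OF r0])
  show "apsis r0 (rright s) < apsis r0 (rleft s)" using apsis_order by simp
  show "{r. 0 < r \<and> radial \<alpha> (energy r0) l r = 0} = {apsis r0 (rright s), apsis r0 (rleft s)}"
    using radial_sign(2) apsis_pos[OF r0] by auto
  fix r assume "r \<in> {apsis r0 (rright s)<..<apsis r0 (rleft s)}"
  then show "0 < radial \<alpha> (energy r0) l r"
    using radial_sign(1)[of r] apsis_pos[OF r0, of "rright s"] by simp
qed (rule l)

text \<open>Both apsides are \<open>r0\<close> times an exponential; \<open>r0\<close> cancels, and
  the remaining quotient is the hyperbolic tangent of half the difference of the exponents.\<close>

lemma eccentricity_apsis:
  "eccentricity (apsis r0 (rright s)) (apsis r0 (rleft s)) = tanh (width s / (2 * q))"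
proof -
  define u where "u = - dlog (1 / rright s) / q"
  define v where "v = - dlog (1 / rleft s) / q"
  have "eccentricity (apsis r0 (rright s)) (apsis r0 (rleft s)) = (r0 * exp v - r0 * exp u) / (r0 * exp v + r0 * exp u)"
    by (simp add: eccentricity_def apsis_def u_def v_def)
  also have "\<dots> = (exp v - exp u) / (exp v + exp u)"
    using r0 by (simp add: distrib_left[symmetric] right_diff_distrib[symmetric])
  also have "\<dots> = (1 - exp u / exp v) / (1 + exp u / exp v)"
  proof -
    have "exp v - exp u = exp v * (1 - exp u / exp v)" "exp v + exp u = exp v * (1 + exp u / exp v)"
      by (simp_all add: right_diff_distrib distrib_left)
    then show ?thesis by simp
  qed
  also have "exp u / exp v = exp (- 2 * ((v - u) / 2))"
    by (simp add: exp_diff[symmetric])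
  also have "(1 - exp (- 2 * ((v - u) / 2))) / (1 + exp (- 2 * ((v - u) / 2))) = tanh ((v - u) / 2)" by (simp only: tanh_real_altdef)
  also have "(v - u) / 2 = width s / (2 * q)"
    using q_pos by (simp add: u_def v_def width_def field_simps)
  finally show ?thesis .
qed

text \<open>
  The substitution \<open>level x = s t\<close> on one side of the bottom of the well, with \<open>\<rho> = 1 / x\<close> the
  corresponding branch and \<open>R\<close> the resulting interval of radii.
\<close>

lemma integral_branch:
  assumes \<rho>: "\<And>u. 0 < u \<Longrightarrow> eps < \<rho> u \<or> \<rho> u < -1" "\<And>u. 0 < u \<Longrightarrow> rlevel (\<rho> u) = u"
    and der: "\<And>u. 0 < u \<Longrightarrow> DERIV \<rho> u :> - rrate (\<rho> u) / (1 + u)"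
    and le: "\<And>u. 0 < u \<Longrightarrow> \<bar>\<rho> u + 1\<bar> \<le> gap u"
    and img: "(\<lambda>t. apsis r0 (\<rho> (s * t))) ` {0<..<1} = R"
  defines "g \<equiv> \<lambda>u. \<bar>\<rho> u + 1\<bar> * sqrt (u / (1 + u))"
  shows "integrable lborel (\<lambda>t. g (s * t) * arcsine t)"
    and "apsidal_integrand \<alpha> (energy r0) l absolutely_integrable_on R"
    and "integral R (apsidal_integrand \<alpha> (energy r0) l) =
      (\<integral>t. g (s * t) * arcsine t \<partial>lborel) / ((1 + eps) * q)"
proof -
  let ?f = "apsidal_integrand \<alpha> (energy r0) l"
  define \<gamma> where "\<gamma> = (\<lambda>t. apsis r0 (\<rho> (s * t)))"
  define \<gamma>' where "\<gamma>' = (\<lambda>t. \<gamma> t * (- ((\<rho> (s * t) + 1) / ((1 + eps) * (1 + s * t)) * s) / q))"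
  obtain C where C: "\<And>u. 0 < u \<Longrightarrow> u \<le> s \<Longrightarrow> weight u \<le> C" using weight_bounded[OF s] by blast
  have cont: "continuous_on {0<..} g"
    unfolding g_def
    by (intro continuous_intros continuous_at_imp_continuous_on ballI DERIV_isCont[OF der]) auto
  have gb: "\<bar>g (s * t)\<bar> \<le> C" if "0 < t" "t < 1" for t
  proof -
    have u: "0 < s * t" "s * t \<le> s" using that s by (auto simp: mult_left_le)
    have "\<bar>g (s * t)\<bar> \<le> weight (s * t)"
      using le[OF u(1)] u unfolding g_def weight_def by (simp add: abs_mult mult_right_mono)
    then show ?thesis using C[OF u] by simp
  qed
  show int: "integrable lborel (\<lambda>t. g (s * t) * arcsine t)"
    by (rule integrable_scaled[OF s cont gb])
  \<comment> \<open>The heart of the substitution: the Jacobian times the apsidal integrand. The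
    radius \<gamma> t and the angular momentum cancel.\<close>
  have e: "\<bar>\<gamma>' t\<bar> * ?f (\<gamma> t) = g (s * t) * arcsine t / ((1 + eps) * q)" if t: "0 < t" "t < 1" for t
  proof -
    define u where "u = s * t"
    \<comment> \<open>This is (1 + s) / (1 + u) - 1, the value of
      \<open>r\<^sup>2 * radial / l\<^sup>2\<close> at the radius \<gamma> t.\<close>
    define c where "c = s * (1 - t) / (1 + u)"
    have u: "0 < u" using t s by (simp add: u_def)
    have c: "0 < c" using t s u by (simp add: c_def)
    note dom = recip_domain[OF \<rho>(1)[OF u]]
    have g0: "0 < \<gamma> t" using apsis_pos[OF r0] by (simp add: \<gamma>_def)
    have co: "coord r0 (\<gamma> t) = 1 / \<rho> u"
      using \<rho>(1)[OF u] r0 by (simp add: \<gamma>_def u_def coord_apsis)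
    have "exp (- dlog (1 / \<rho> u)) * (1 + 1 / \<rho> u) = 1 / (1 + level (1 / \<rho> u))"
      using dom by (simp add: level_def exp_minus field_simps)
    also have "level (1 / \<rho> u) = u" using \<rho>(2)[OF u] by (simp add: rlevel_def)
    finally have "(\<gamma> t)\<^sup>2 * radial \<alpha> (energy r0) l (\<gamma> t) / l\<^sup>2 = (1 + s) * (1 / (1 + u)) - 1"
      using radial_profile[OF r0 g0 l] by (simp add: peak co)
    also have "\<dots> = c" using u by (simp add: c_def u_def field_simps)
    finally have rad: "radial \<alpha> (energy r0) l (\<gamma> t) = (l / \<gamma> t)\<^sup>2 * c"
      using g0 l by (simp add: power_divide field_simps)
    have "sqrt (radial \<alpha> (energy r0) l (\<gamma> t)) = l / \<gamma> t * sqrt c"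
      unfolding rad real_sqrt_mult real_sqrt_abs using g0 l by simp
    then have "?f (\<gamma> t) = 1 / (\<gamma> t * sqrt c)"
      using g0 l by (simp add: apsidal_integrand_def power2_eq_square)
    moreover have "\<bar>\<gamma>' t\<bar> = \<gamma> t * (\<bar>\<rho> u + 1\<bar> * s / ((1 + eps) * (1 + u) * q))"
      using g0 u s q_pos eps_nonneg by (simp add: \<gamma>'_def u_def[symmetric] abs_mult)
    ultimately have "\<bar>\<gamma>' t\<bar> * ?f (\<gamma> t) = \<bar>\<rho> u + 1\<bar> / ((1 + eps) * q) * (s / ((1 + u) * sqrt c))"
      using g0 by simp
    also have "s / ((1 + u) * sqrt c) = sqrt (u / (1 + u)) / sqrt (t * (1 - t))"
    proof -
      have "(s / ((1 + u) * sqrt c))\<^sup>2 = (sqrt (u / (1 + u)) / sqrt (t * (1 - t)))\<^sup>2"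
      proof -
        have "(s / ((1 + u) * sqrt c))\<^sup>2 = s\<^sup>2 / ((1 + u)\<^sup>2 * c)"
          using c by (simp add: power_divide power_mult_distrib)
        also have "\<dots> = s / ((1 + u) * (1 - t))"
          using u s t by (simp add: c_def power2_eq_square divide_simps)
        also have "\<dots> = (s * t) / (1 + u) / (t * (1 - t))" using t by simp
        also have "\<dots> = (sqrt (u / (1 + u)) / sqrt (t * (1 - t)))\<^sup>2"
          using u t by (simp add: power_divide u_def)
        finally show ?thesis .
      qed
      then show ?thesis by (rule power2_eq_imp_eq) (use c u t s in auto)
    qed
    finally show ?thesis using t by (simp add: g_def u_def arcsine_def)
  qed
  have S: "{0<..<1::real} \<in> sets lebesgue" by simp
  have der\<gamma>: "(\<gamma> has_field_derivative \<gamma>' t) (at t within {0<..<1})" if "t \<in> {0<..<1}" for t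
  proof -
    have u: "0 < s * t" using that s by simp
    have "DERIV (\<lambda>t. s * t) t :> s" by (auto intro!: derivative_eq_intros)
    from DERIV_chain2[OF DERIV_dlog_branch[of \<rho>, OF \<rho>(1)[OF u] der[OF u] u] this]
    have "DERIV (\<lambda>t. dlog (1 / \<rho> (s * t))) t :> (\<rho> (s * t) + 1) / ((1 + eps) * (1 + s * t)) * s" .
    then have "DERIV (\<lambda>t. - dlog (1 / \<rho> (s * t)) / q) t :> - ((\<rho> (s * t) + 1) / ((1 + eps) * (1 + s * t)) * s) / q"
      by (intro DERIV_cdivide DERIV_minus)
    from DERIV_cmult[OF DERIV_chain2[OF DERIV_exp this], of r0]
    have "DERIV \<gamma> t :> \<gamma>' t" by (simp add: \<gamma>_def \<gamma>'_def apsis_def mult.assoc)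
    then show ?thesis by (rule has_field_derivative_at_within)
  qed
  \<comment> \<open>The radius determines the coordinate, hence the branch value, and
    \<open>rlevel\<close> recovers s t from it.\<close>
  have inj: "inj_on \<gamma> {0<..<1}"
  proof (rule inj_onI)
    fix t t' assume t: "t \<in> {0<..<1}" "t' \<in> {0<..<1}" "\<gamma> t = \<gamma> t'"
    then have u: "0 < s * t" "0 < s * t'" using s by auto
    have "coord r0 (\<gamma> t) = coord r0 (\<gamma> t')" by (simp only: t(3))
    then have "1 / \<rho> (s * t) = 1 / \<rho> (s * t')"
      by (simp only: \<gamma>_def coord_apsis[OF r0 \<rho>(1)[OF u(1)]] coord_apsis[OF r0 \<rho>(1)[OF u(2)]])
    then have "rlevel (\<rho> (s * t)) = rlevel (\<rho> (s * t'))" by (simp only: rlevel_def)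
    then have "s * t = s * t'" by (simp only: \<rho>(2)[OF u(1)] \<rho>(2)[OF u(2)])
    then show "t = t'" using s by simp
  qed
  let ?h = "\<lambda>t. \<bar>\<gamma>' t\<bar> * ?f (\<gamma> t)"
  have h: "indicator {0<..<1} t *\<^sub>R ?h t = g (s * t) * arcsine t / ((1 + eps) * q)" for t
    using e[of t] by (auto simp: indicator_def arcsine_def)
  have "set_integrable lborel {0<..<1} ?h"
    unfolding set_integrable_def h using int by simp
  moreover have "(LINT t:{0<..<1}|lborel. ?h t) = (\<integral>t. g (s * t) * arcsine t \<partial>lborel) / ((1 + eps) * q)"
    unfolding set_lebesgue_integral_def h by simp
  ultimately have "?h absolutely_integrable_on {0<..<1} \<and>
      integral {0<..<1} ?h = (\<integral>t. g (s * t) * arcsine t \<partial>lborel) / ((1 + eps) * q)"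
    using set_borel_integral_eq_integral(2)[of "{0<..<1}" ?h]
    by (auto simp: set_integrable_def integrable_completion borel_measurable_integrable)
  then have "?f absolutely_integrable_on (\<gamma> ` {0<..<1}) \<and>
      integral (\<gamma> ` {0<..<1}) ?f = (\<integral>t. g (s * t) * arcsine t \<partial>lborel) / ((1 + eps) * q)"
    using has_absolute_integral_change_of_variables_1'[OF S der\<gamma> inj, of ?f
        "(\<integral>t. g (s * t) * arcsine t \<partial>lborel) / ((1 + eps) * q)"] by blast
  then show "?f absolutely_integrable_on R"
    "integral R ?f = (\<integral>t. g (s * t) * arcsine t \<partial>lborel) / ((1 + eps) * q)"
    using img by (auto simp: \<gamma>_def)
qed

lemma apsis_image_right:
  "(\<lambda>t. apsis r0 (rright (s * t))) ` {0<..<1} = {apsis r0 (rright s)<..<r0}"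
proof (intro equalityI subsetI)
  fix r assume "r \<in> (\<lambda>t. apsis r0 (rright (s * t))) ` {0<..<1}"
  then obtain t where t: "0 < t" "t < 1" "r = apsis r0 (rright (s * t))" by auto
  have u: "0 < s * t" "s * t < s" using t s by auto
  have "1 / rright (s * t) < 1 / rright s" "0 < 1 / rright (s * t)"
    using rright_gt[OF rright(1)[OF s] u(1)] u rright[OF s] rright[OF u(1)] eps_nonneg
    by (auto simp: field_simps)
  then have "coord r0 r < coord r0 (apsis r0 (rright s))" "coord r0 r0 < coord r0 r"
    using rright[OF s] rright[OF u(1)] r0 by (simp_all add: coord_apsis coord_center t)
  then show "r \<in> {apsis r0 (rright s)<..<r0}"
    using apsis_pos[OF r0] r0 t by (simp add: coord_less_iff)
next
  fix r assume r: "r \<in> {apsis r0 (rright s)<..<r0}"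
  then have rp: "0 < r" using apsis_pos[OF r0, of "rright s"] by simp
  define x where "x = coord r0 r"
  have "coord r0 r0 < x" "x < coord r0 (apsis r0 (rright s))"
    unfolding x_def using r rp apsis_pos[OF r0] r0 by (simp_all add: coord_less_iff)
  then have x: "0 < x" "x < 1 / rright s" using rright[OF s] r0 by (simp_all add: coord_apsis coord_center)
  have e: "eps < 1 / x" using x coord_dom[of r0 r] by (simp add: x_def field_simps)
  have lt: "rright s < 1 / x" using x rright[OF s] eps_nonneg by (simp add: field_simps)
  define t where "t = rlevel (1 / x) / s"
  have st: "s * t = rlevel (1 / x)" using s by (simp add: t_def)
  have "0 < t" "t < 1"
    using rlevel_pos[of "1 / x"] rlevel_strict_antimono_right[OF rright(1)[OF s] lt] e s rright[OF s]
    by (simp_all add: t_def)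
  moreover have "coord r0 (apsis r0 (rright (s * t))) = coord r0 r"
    unfolding st rright_rlevel[OF e] using e r0 by (simp add: coord_apsis x_def)
  then have "r = apsis r0 (rright (s * t))"
    using coord_eq_iff[OF r0 apsis_pos[OF r0] rp] by auto
  ultimately show "r \<in> (\<lambda>t. apsis r0 (rright (s * t))) ` {0<..<1}" by auto
qed

lemma apsis_image_left:
  "(\<lambda>t. apsis r0 (rleft (s * t))) ` {0<..<1} = {r0<..<apsis r0 (rleft s)}"
proof (intro equalityI subsetI)
  fix r assume "r \<in> (\<lambda>t. apsis r0 (rleft (s * t))) ` {0<..<1}"
  then obtain t where t: "0 < t" "t < 1" "r = apsis r0 (rleft (s * t))" by auto
  have u: "0 < s * t" "s * t < s" using t s by auto
  note l = rleft[OF s] rleft[OF u(1)]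
  have recip: "1 / b < 1 / a" if "a < b" "b < 0" for a b :: real
    using that by (simp add: field_simps)
  have "1 / rleft s < 1 / rleft (s * t)" "1 / rleft (s * t) < 0"
    using recip[OF rleft_less[OF u]] l by simp_all
  then have "coord r0 (apsis r0 (rleft s)) < coord r0 r" "coord r0 r < coord r0 r0"
    using l r0 by (simp_all add: coord_apsis coord_center t)
  then show "r \<in> {r0<..<apsis r0 (rleft s)}"
    using apsis_pos[OF r0] r0 t by (simp add: coord_less_iff)
next
  fix r assume r: "r \<in> {r0<..<apsis r0 (rleft s)}"
  then have rp: "0 < r" using r0 by simp
  note l = rleft[OF s]
  define x where "x = coord r0 r"
  have "x < coord r0 r0" "coord r0 (apsis r0 (rleft s)) < x"
    unfolding x_def using r rp apsis_pos[OF r0] r0 by (simp_all add: coord_less_iff)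
  then have x: "x < 0" "1 / rleft s < x" using l r0 by (simp_all add: coord_apsis coord_center)
  have lt: "1 / x < rleft s" using x l by (simp add: field_simps)
  then have e: "1 / x < -1" using l by simp
  define t where "t = rlevel (1 / x) / s"
  have st: "s * t = rlevel (1 / x)" using s by (simp add: t_def)
  have "0 < t" "t < 1"
    using rlevel_pos[of "1 / x"] rlevel_strict_mono_left[OF lt l(1)] e s l
    by (simp_all add: t_def)
  moreover have "coord r0 (apsis r0 (rleft (s * t))) = coord r0 r"
    unfolding st rleft_rlevel[OF e] using e r0 by (simp add: coord_apsis x_def)
  then have "r = apsis r0 (rleft (s * t))"
    using coord_eq_iff[OF r0 apsis_pos[OF r0] rp] by auto
  ultimately show "r \<in> (\<lambda>t. apsis r0 (rleft (s * t))) ` {0<..<1}" by auto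
qed

lemma branch_le_gap:
  assumes "0 < u"
  shows "\<bar>rright u + 1\<bar> \<le> gap u" "\<bar>rleft u + 1\<bar> \<le> gap u"
    "\<bar>rright u + 1\<bar> + \<bar>rleft u + 1\<bar> = gap u"
  using rright[OF assms] rleft[OF assms] eps_nonneg by (auto simp: gap_def)

lemma orbit_angle_apsis:
  defines "rm \<equiv> apsis r0 (rright s)" and "rp \<equiv> apsis r0 (rleft s)"
  shows "set_integrable lborel {rm<..<rp} (apsidal_integrand \<alpha> (energy r0) l)"
    and "orbit_apsidal_angle \<alpha> (energy r0) l rm rp = period s / ((1 + eps) * q)"
proof -
  let ?f = "apsidal_integrand \<alpha> (energy r0) l"
  let ?R = "{rm<..<r0}" and ?L = "{r0<..<rp}"
  have R: "integrable lborel (\<lambda>t. \<bar>rright (s * t) + 1\<bar> * sqrt (s * t / (1 + s * t)) * arcsine t)"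
    "?f absolutely_integrable_on ?R"
    "integral ?R ?f = (\<integral>t. \<bar>rright (s * t) + 1\<bar> * sqrt (s * t / (1 + s * t)) * arcsine t \<partial>lborel) / ((1 + eps) * q)"
    unfolding rm_def
    by (rule integral_branch[OF disjI1[OF rright(1)] rright(2) DERIV_rright branch_le_gap(1) apsis_image_right]; assumption)+
  have L: "integrable lborel (\<lambda>t. \<bar>rleft (s * t) + 1\<bar> * sqrt (s * t / (1 + s * t)) * arcsine t)"
    "?f absolutely_integrable_on ?L"
    "integral ?L ?f = (\<integral>t. \<bar>rleft (s * t) + 1\<bar> * sqrt (s * t / (1 + s * t)) * arcsine t \<partial>lborel) / ((1 + eps) * q)"
    unfolding rp_def
    by (rule integral_branch[OF disjI2[OF rleft(1)] rleft(2) DERIV_rleft branch_le_gap(2) apsis_image_left]; assumption)+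
  have U: "{rm<..<rp} = insert r0 (?R \<union> ?L)"
    using apsis_order by (auto simp: rm_def rp_def)
  have n1: "negligible {x \<in> (?R \<union> ?L) - {rm<..<rp}. ?f x \<noteq> 0}" and
    n2: "negligible {x \<in> {rm<..<rp} - (?R \<union> ?L). ?f x \<noteq> 0}"
    unfolding U by (rule negligible_subset[of "{r0}"]; auto)+
  have "?f absolutely_integrable_on (?R \<union> ?L)" by (intro absolutely_integrable_Un R L)
  then have abs: "?f absolutely_integrable_on {rm<..<rp}"
    using absolutely_integrable_spike_set_eq[OF n1 n2] by simp
  have pos: "0 < rm" "\<And>r. r \<in> {rm<..<rp} \<Longrightarrow> 0 < radial \<alpha> (energy r0) l r"
    using bounded_orbit_apsis by (auto simp: bounded_orbit_def rm_def rp_def)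
  \<comment> \<open>Continuity supplies Borel measurability, with which absolute integrability in
    the Lebesgue sense passes to \<open>lborel\<close>.\<close>
  have "continuous_on {rm<..<rp} (V \<alpha>)"
    unfolding V_def[abs_def] using pos(1)
    by (cases "\<alpha> = 0") (auto intro!: continuous_intros)
  then have "continuous_on {rm<..<rp} (radial \<alpha> (energy r0) l)"
    unfolding radial_def[abs_def] using pos(1) by (intro continuous_intros) auto
  moreover have "r\<^sup>2 * sqrt (radial \<alpha> (energy r0) l r) \<noteq> 0" if "r \<in> {rm<..<rp}" for r
    using pos(1) pos(2)[OF that] that by simp
  ultimately have "continuous_on {rm<..<rp} ?f"
    unfolding apsidal_integrand_def[abs_def] by (intro continuous_intros) auto
  then have meas: "(\<lambda>r. indicator {rm<..<rp} r *\<^sub>R ?f r) \<in> borel_measurable borel"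
    by (intro borel_measurable_continuous_on_indicator) auto
  then show si: "set_integrable lborel {rm<..<rp} ?f"
    using abs by (simp add: set_integrable_def integrable_completion)
  have "orbit_apsidal_angle \<alpha> (energy r0) l rm rp = integral {rm<..<rp} ?f"
    unfolding orbit_apsidal_angle_def by (rule set_borel_integral_eq_integral(2)[OF si])
  also have "\<dots> = integral (?R \<union> ?L) ?f"
    by (rule integral_spike_set) (use n1 n2 in auto)
  also have "\<dots> = integral ?R ?f + integral ?L ?f"
    using R(2) L(2) by (intro Henstock_Kurzweil_Integration.integral_Un)
      (auto simp: set_lebesgue_integral_eq_integral)
  also have "\<dots> = period s / ((1 + eps) * q)"
  proof -
    have "period s = (\<integral>t. \<bar>rright (s * t) + 1\<bar> * sqrt (s * t / (1 + s * t)) * arcsine t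
        + \<bar>rleft (s * t) + 1\<bar> * sqrt (s * t / (1 + s * t)) * arcsine t \<partial>lborel)"
      unfolding period_def
    proof (rule Bochner_Integration.integral_cong)
      fix t :: real
      show "weight (s * t) * arcsine t = \<bar>rright (s * t) + 1\<bar> * sqrt (s * t / (1 + s * t)) * arcsine t
        + \<bar>rleft (s * t) + 1\<bar> * sqrt (s * t / (1 + s * t)) * arcsine t"
      proof (cases "0 < t \<and> t < 1")
        case True
        then show ?thesis
          using s by (simp add: weight_def branch_le_gap(3)[symmetric] distrib_right)
      qed (auto simp: arcsine_def)
    qed simp
    also have "\<dots> = (\<integral>t. \<bar>rright (s * t) + 1\<bar> * sqrt (s * t / (1 + s * t)) * arcsine t \<partial>lborel)
        + (\<integral>t. \<bar>rleft (s * t) + 1\<bar> * sqrt (s * t / (1 + s * t)) * arcsine t \<partial>lborel)"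
      by (rule Bochner_Integration.integral_add[OF R(1) L(1)])
    finally show ?thesis unfolding R(3) L(3) by (simp add: add_divide_distrib)
  qed
  finally show "orbit_apsidal_angle \<alpha> (energy r0) l rm rp = period s / ((1 + eps) * q)" .
qed

end

section \<open>Normal form of an arbitrary bounded orbit\<close>

lemma bounded_orbit_center:
  assumes "bounded_orbit \<alpha> E l rm rp"
  shows "\<exists>r0. rm < r0 \<and> r0 < rp \<and> E = energy r0"
proof -
  have o: "0 < l" "0 < rm" "rm < rp" "radial \<alpha> E l rm = 0" "radial \<alpha> E l rp = 0"
    using assms by (auto simp: bounded_orbit_def)
  have dV: "DERIV (V \<alpha>) r :> - (r powr (- \<alpha>) / r)" if "0 < r" for r
  proof (cases "\<alpha> = 0")
    case True
    then show ?thesis using that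
      by (auto simp: V_def[abs_def] intro!: derivative_eq_intros)
  next
    case False
    have "DERIV (\<lambda>r. (1 / \<alpha>) * r powr (- \<alpha>)) r :> (1 / \<alpha>) * (- \<alpha> * r powr (- \<alpha> - 1))"
      using that by (intro DERIV_cmult has_real_derivative_powr)
    then have "DERIV (\<lambda>r. (1 / \<alpha>) * (1 / r powr \<alpha>)) r :> - (r powr (- \<alpha>) / r)"
      using False that by (simp add: powr_minus powr_diff inverse_eq_divide)
    then show ?thesis using False by (simp add: V_def[abs_def])
  qed
  let ?p = "\<lambda>r. r\<^sup>2 * (2 * (E + V \<alpha> r))"
  have dp: "DERIV ?p r :> 2 * r * (2 * (E + V \<alpha> r)) + - (r powr (- \<alpha>) / r) * 2 * r\<^sup>2" if "0 < r" for r
  proof -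
    have "DERIV (\<lambda>r. r\<^sup>2) r :> 2 * r" by (auto intro!: derivative_eq_intros)
    moreover have "DERIV (\<lambda>r. 2 * (E + V \<alpha> r)) r :> - (r powr (- \<alpha>) / r) * 2"
      using DERIV_cmult[OF DERIV_add[OF DERIV_const dV[OF that]], of 2] by (simp add: mult.commute)
    ultimately show ?thesis by (rule DERIV_mult)
  qed
  have p: "?p r = l\<^sup>2" if "0 < r" "radial \<alpha> E l r = 0" for r
    using that by (simp add: radial_def field_simps)
  \<comment> \<open>Rolle's theorem applies because \<open>?p\<close> equals
    \<open>l\<^sup>2\<close> at both apsides. A critical point of \<open>?p\<close> is a radius
    whose \<open>energy\<close> is \<open>E\<close>.\<close>
  have "\<exists>z. rm < z \<and> z < rp \<and> (*) (2 * z * (2 * (E + V \<alpha> z)) + - (z powr (- \<alpha>) / z) * 2 * z\<^sup>2) = (\<lambda>v. 0)"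
  proof (rule Rolle_deriv[of rm rp ?p "\<lambda>r. (*) (2 * r * (2 * (E + V \<alpha> r)) + - (r powr (- \<alpha>) / r) * 2 * r\<^sup>2)"])
    show "?p rm = ?p rp" using o by (simp only: p)
    show "continuous_on {rm..rp} ?p"
      using o by (intro continuous_at_imp_continuous_on ballI DERIV_isCont[OF dp]) auto
    show "(?p has_derivative (*) (2 * z * (2 * (E + V \<alpha> z)) + - (z powr (- \<alpha>) / z) * 2 * z\<^sup>2)) (at z)"
      if "rm < z" "z < rp" for z
      using dp[of z] that o by (simp add: has_field_derivative_def)
  qed (use o in auto)
  then obtain z where z: "rm < z" "z < rp"
    "(*) (2 * z * (2 * (E + V \<alpha> z)) + - (z powr (- \<alpha>) / z) * 2 * z\<^sup>2) = (\<lambda>v. 0)" by blast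
  have "2 * z * (2 * (E + V \<alpha> z)) + - (z powr (- \<alpha>) / z) * 2 * z\<^sup>2 = 0"
    using fun_cong[OF z(3), of 1] by simp
  moreover have "2 * z * (2 * (E + V \<alpha> z)) + - (z powr (- \<alpha>) / z) * 2 * z\<^sup>2 =
      4 * z * (E - energy z)"
  proof -
    have "z powr (- \<alpha>) / z * 2 * z\<^sup>2 = 2 * z * z powr (- \<alpha>)"
      using z(1) o(2) by (simp add: power2_eq_square)
    then show ?thesis by (simp add: energy_def algebra_simps)
  qed
  ultimately have "E = energy z" using z o by simp
  with z show ?thesis by blast
qed

text \<open>The centre lies strictly between the apsides, where \<open>radial\<close> is positive,
  so the peak exceeds 1. The zero set of \<open>radial\<close> then identifies the apsides as a
  pair, and their order settles which is which.\<close>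

lemma bounded_orbit_cases:
  assumes "bounded_orbit \<alpha> E l rm rp"
  obtains r0 s where "0 < r0" "0 < l" "0 < s" "peak r0 l = 1 + s" "E = energy r0"
    "rm = apsis r0 (rright s)" "rp = apsis r0 (rleft s)"
proof -
  obtain r0 where r0: "rm < r0" "r0 < rp" "E = energy r0"
    using bounded_orbit_center[OF assms] by blast
  have o: "0 < l" "0 < rm" "rm < rp" "{r. 0 < r \<and> radial \<alpha> E l r = 0} = {rm, rp}"
    "0 < radial \<alpha> E l r0"
    using assms r0 by (auto simp: bounded_orbit_def)
  define s where "s = peak r0 l - 1"
  have p0: "0 < r0" using r0 o by simp
  have "r0\<^sup>2 * radial \<alpha> E l r0 / l\<^sup>2 = s"
    using radial_profile[OF p0 p0 o(1)] p0 by (simp add: s_def r0(3) coord_center)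
  moreover have "0 < r0\<^sup>2 * radial \<alpha> E l r0 / l\<^sup>2" using o p0 by simp
  ultimately have s: "0 < s" "peak r0 l = 1 + s" by (auto simp: s_def)
  have "{r. 0 < r \<and> radial \<alpha> E l r = 0} = {apsis r0 (rright s), apsis r0 (rleft s)}"
    "apsis r0 (rright s) < apsis r0 (rleft s)"
    using bounded_orbit_apsis[OF p0 o(1) s] by (auto simp: bounded_orbit_def r0(3))
  moreover from this(1) have "rm = apsis r0 (rright s) \<and> rp = apsis r0 (rleft s) \<or>
      rm = apsis r0 (rleft s) \<and> rp = apsis r0 (rright s)"
    unfolding o(4) doubleton_eq_iff .
  ultimately have "rm = apsis r0 (rright s)" "rp = apsis r0 (rleft s)"
    using o(3) by linarith+
  then show ?thesis using that p0 o(1) s r0(3) by blast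
qed

section \<open>The apsidal angle as a function of the eccentricity\<close>

lemma tanh_half_width_inv:
  assumes "0 < w" "0 < e" "e < 1"
  shows "tanh (w / (2 * q)) = e \<longleftrightarrow> w = 2 * q * artanh e"
proof -
  have "tanh (w / (2 * q)) = e \<longleftrightarrow> w / (2 * q) = artanh e"
    using assms artanh_tanh_real[of "w / (2 * q)"] tanh_artanh_real[of e] by auto
  also have "\<dots> \<longleftrightarrow> w = 2 * q * artanh e" using q_pos by (simp add: field_simps)
  finally show ?thesis .
qed

definition well_depth :: "real \<Rightarrow> real" where
  "well_depth e = width_inv (2 * q * artanh e)"

lemma well_depth:
  assumes "0 < e" "e < 1"
  shows "0 < well_depth e" "tanh (width (well_depth e) / (2 * q)) = e"
    "\<And>s. 0 < s \<Longrightarrow> tanh (width s / (2 * q)) = e \<Longrightarrow> s = well_depth e"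
proof -
  have w: "0 < 2 * q * artanh e" using artanh_pos[OF assms] q_pos by simp
  note i = width_inv[OF w]
  show "0 < well_depth e" using i by (simp add: well_depth_def)
  show "tanh (width (well_depth e) / (2 * q)) = e"
    using tanh_half_width_inv[OF w assms] i by (simp add: well_depth_def)
  show "s = well_depth e" if "0 < s" "tanh (width s / (2 * q)) = e" for s
    using that tanh_half_width_inv[OF width_pos[OF that(1)] assms] width_inv_width[OF that(1)]
    by (simp add: well_depth_def)
qed

lemma ex_bounded_orbit:
  assumes "0 < s"
  shows "\<exists>E l rm rp. bounded_orbit \<alpha> E l rm rp \<and> eccentricity rm rp = tanh (width s / (2 * q)) \<and>
    orbit_apsidal_angle \<alpha> E l rm rp = period s / ((1 + eps) * q)"
proof -
  \<comment> \<open>With centre 1 the peak is the inverse square of \<open>l\<close>, so this choice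
    gives 1 + s.\<close>
  define l where "l = 1 / sqrt (1 + s)"
  have "0 < l" "peak 1 l = 1 + s" using assms by (auto simp: l_def peak_def power_divide)
  note o = zero_less_one this(1) assms this(2)
  show ?thesis
    using bounded_orbit_apsis[OF o] eccentricity_apsis[OF o] orbit_angle_apsis(2)[OF o] by blast
qed

text \<open>The eccentricity determines \<open>s\<close>, and the angle depends on the orbit only
  through \<open>s\<close>; hence the definite description has exactly one candidate.\<close>

lemma apsidal_angle_eq:
  assumes "0 < e" "e < 1"
  shows "apsidal_angle \<alpha> e = period (well_depth e) / ((1 + eps) * q)"
  unfolding apsidal_angle_def
proof (rule the_equality)
  show "\<exists>E l rm rp. bounded_orbit \<alpha> E l rm rp \<and> eccentricity rm rp = e \<and>
      period (well_depth e) / ((1 + eps) * q) = orbit_apsidal_angle \<alpha> E l rm rp"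
    using ex_bounded_orbit[OF well_depth(1)[OF assms]] well_depth(2)[OF assms] by metis
next
  fix T assume "\<exists>E l rm rp. bounded_orbit \<alpha> E l rm rp \<and> eccentricity rm rp = e \<and>
      T = orbit_apsidal_angle \<alpha> E l rm rp"
  then obtain E l rm rp where *: "bounded_orbit \<alpha> E l rm rp" "eccentricity rm rp = e"
    "T = orbit_apsidal_angle \<alpha> E l rm rp" by blast
  obtain r0 s where o: "0 < r0" "0 < l" "0 < s" "peak r0 l = 1 + s"
    and eq: "E = energy r0" "rm = apsis r0 (rright s)" "rp = apsis r0 (rleft s)"
    using bounded_orbit_cases[OF *(1)] by metis
  have "s = well_depth e"
    using well_depth(3)[OF assms o(3)] eccentricity_apsis[OF o] *(2) by (simp add: eq)
  then show "T = period (well_depth e) / ((1 + eps) * q)"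
    using orbit_angle_apsis(2)[OF o] *(3) by (simp add: eq)
qed

text \<open>Chain rule: the width 2 q artanh e and the parameter \<open>width_inv\<close> of that
  width both have positive derivative, while \<open>period\<close> has a negative one.\<close>

lemma DERIV_apsidal_angle:
  assumes e: "0 < e" "e < 1"
  shows "\<exists>d<0. DERIV (apsidal_angle \<alpha>) e :> d"
proof -
  have w: "0 < 2 * q * artanh e" using artanh_pos[OF e] q_pos by simp
  obtain d1 where d1: "d1 > 0" "DERIV width_inv (2 * q * artanh e) :> d1"
    using DERIV_width_inv[OF w] by blast
  have "DERIV artanh e :> 1 / (1 - e\<^sup>2)"
    using e by (intro artanh_real_has_field_derivative) auto
  from DERIV_chain2[OF d1(2) DERIV_cmult[OF this, of "2 * q"]]
  have dd: "DERIV well_depth e :> d1 * (2 * q * (1 / (1 - e\<^sup>2)))"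
    unfolding well_depth_def[abs_def] .
  obtain d2 where d2: "d2 < 0" "DERIV period (well_depth e) :> d2"
    using period_decreasing[OF well_depth(1)[OF e]] by blast
  define d where "d = d2 * (d1 * (2 * q * (1 / (1 - e\<^sup>2)))) / ((1 + eps) * q)"
  have D: "DERIV (\<lambda>e. period (well_depth e) / ((1 + eps) * q)) e :> d"
    unfolding d_def by (intro DERIV_cdivide DERIV_chain2[OF d2(2) dd])
  have "e * e < 1 * 1" using e by (intro mult_strict_mono) auto
  then have "0 < d1 * (2 * q * (1 / (1 - e\<^sup>2)))" using d1 q_pos by (simp add: power2_eq_square)
  from mult_neg_pos[OF d2(1) this] have "d < 0"
    unfolding d_def by (rule divide_neg_pos) (use q_pos eps_nonneg in simp)
  moreover have "DERIV (apsidal_angle \<alpha>) e :> d"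
  \<comment> \<open>The closed formula is known for eccentricities in (0, 1), so the two functions
    are identified in a neighbourhood of \<open>e\<close>.\<close>
  proof (rule DERIV_cong_ev[THEN iffD2, OF refl _ refl D])
    show "\<forall>\<^sub>F x in nhds e. apsidal_angle \<alpha> x = period (well_depth x) / ((1 + eps) * q)"
      using eventually_nhds_in_open[of "{0<..<1}" e] e
      by (auto elim!: eventually_mono simp: apsidal_angle_eq)
  qed
  ultimately show ?thesis by blast
qed

end

text \<open>The first two conjuncts make \<open>apsidal_angle\<close> meaningful: orbits of every
  eccentricity exist, their integrals converge, and all orbits of one eccentricity share the value.
  Differentiability is stated beside the sign of \<open>deriv\<close> because \<open>deriv\<close>
  is total.\<close>

theorem theorem1p1:
  fixes \<alpha> :: real
  assumes "- 2 < \<alpha>" and "\<alpha> < 1"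
  shows "(\<forall>e\<in>{0<..<1}. \<exists>E l rm rp. bounded_orbit \<alpha> E l rm rp \<and> eccentricity rm rp = e) \<and>
    (\<forall>E l rm rp. bounded_orbit \<alpha> E l rm rp \<longrightarrow>
       set_integrable lborel {rm<..<rp} (apsidal_integrand \<alpha> E l) \<and>
       orbit_apsidal_angle \<alpha> E l rm rp = apsidal_angle \<alpha> (eccentricity rm rp)) \<and>
    strict_antimono_on {0<..<1} (apsidal_angle \<alpha>) \<and>
    (\<forall>e\<in>{0<..<1}. apsidal_angle \<alpha> differentiable (at e) \<and> deriv (apsidal_angle \<alpha>) e < 0)"
proof -
  interpret power_law \<alpha> by unfold_locales (use assms in auto)
  have der: "\<exists>d<0. DERIV (apsidal_angle \<alpha>) e :> d" if "e \<in> {0<..<1}" for e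
    using DERIV_apsidal_angle[of e] that by simp
  show ?thesis
  proof (intro conjI ballI allI impI)
    fix e :: real assume e: "e \<in> {0<..<1}"
    then show "\<exists>E l rm rp. bounded_orbit \<alpha> E l rm rp \<and> eccentricity rm rp = e"
      using ex_bounded_orbit[OF well_depth(1)] well_depth(2)[of e] by fastforce
    show "apsidal_angle \<alpha> differentiable at e"
      using der[OF e] by (auto simp: real_differentiable_def)
    show "deriv (apsidal_angle \<alpha>) e < 0"
      using der[OF e] DERIV_imp_deriv by blast
  next
    fix E l rm rp assume "bounded_orbit \<alpha> E l rm rp"
    then obtain r0 s where o: "0 < r0" "0 < l" "0 < s" "peak r0 l = 1 + s"
      and eq: "E = energy r0" "rm = apsis r0 (rright s)" "rp = apsis r0 (rleft s)"
      using bounded_orbit_cases by metis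
    show "set_integrable lborel {rm<..<rp} (apsidal_integrand \<alpha> E l)"
      using orbit_angle_apsis(1)[OF o] by (simp add: eq)
    define e where "e = eccentricity rm rp"
    have t: "tanh (width s / (2 * q)) = e" using eccentricity_apsis[OF o] by (simp add: e_def eq)
    have "0 < width s / (2 * q)" using width_pos[OF o(3)] q_pos by simp
    then have e: "0 < e" "e < 1" unfolding t[symmetric] by (simp_all add: tanh_real_lt_1)
    have "s = well_depth e" using well_depth(3)[OF e o(3) t] .
    then have "orbit_apsidal_angle \<alpha> E l rm rp = apsidal_angle \<alpha> e"
      using orbit_angle_apsis(2)[OF o] by (simp add: eq apsidal_angle_eq[OF e])
    then show "orbit_apsidal_angle \<alpha> E l rm rp = apsidal_angle \<alpha> (eccentricity rm rp)"
      by (simp add: e_def)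
  next
    show "strict_antimono_on {0<..<1} (apsidal_angle \<alpha>)"
    proof (rule monotone_onI)
      fix x y :: real assume xy: "x \<in> {0<..<1}" "y \<in> {0<..<1}" "x < y"
      show "apsidal_angle \<alpha> y < apsidal_angle \<alpha> x"
      proof (rule DERIV_neg_imp_decreasing[OF xy(3)])
        fix z assume "x \<le> z" "z \<le> y"
        then show "\<exists>d. DERIV (apsidal_angle \<alpha>) z :> d \<and> d < 0" using der[of z] xy by auto
      qed
    qed
  qed
qed

end
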